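(* Assume $R_\ell D=D$ and $a=0$. Then the first-order capacitance correction $C^1$ satisfies $C^1q=0$ for every $q\in\mathbb C^N$ with $\Pi q=-q$.
   Context: $d\in\{2,3\}$; $x=(x_\ell,x_d)\in\mathbb R^{d-1}\times\mathbb R$; $L>0$, $\Lambda=L\mathbb Z^{d-1}$, $\Lambda^*=(2\pi/L)\mathbb Z^{d-1}$, $Y=[-L/2,L/2]^{d-1}$, $|Y|=L^{d-1}$, $\Omega=Y\times\mathbb R$. $D_1,\dots,D_N\subset\Omega$ are bounded connected open sets with $C^2$ boundaries, whose closures and all their translates by $\Lambda\times\{0\}$ are pairwise disjoint; $D=\bigcup_jD_j$; $\langle\phi,\psi\rangle_{\partial D_i}=\int_{\partial D_i}\phi\overline\psi\,d\sigma$. $R_\ell(x_\ell,x_d)=(-x_\ell,x_d)$; when $R_\ell D=D$, $\pi$ is the involutive permutation of $\{1,\dots,N\}$ with $R_\ell D_i=D_{\pi(i)}$ and $\Pi$ is the permutation matrix $(\Pi q)_i=q_{\pi(i)}$. First-order capacitance matrix at $a=0$ (Bloch parameter $\alpha=\omega a=0$). Fix $c>0$. For complex $\omega\ne0$ with $|\omega|<2\pi c/L$ let $k=\omega/c$ and $G^{0,k}(x)=\sum_{\eta\in\Lambda^*}\frac{e^{\mathrm i\eta\cdot x_\ell}e^{\mathrm i\beta_\eta|x_d|}}{2|Y|\mathrm i\beta_\eta}$ with $\beta_0=\omega/c$ and, for $\eta\ne0$, $\beta_\eta=\sqrt{k^2-|\eta|^2}$ the branch holomorphic in $\omega$ equal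 to $\mathrm i|\eta|$ at $\omega=0$. Let $\mathcal S_D^{0,k}[\psi](x)=\int_{\partial D}G^{0,k}(x-y)\psi(y)\,d\sigma(y)$, an operator $H^{-1/2}(\partial D)\to H^{1/2}(\partial D)$. For small $\omega\neq0$ it is boundedly invertible and its inverse extends holomorphically to a neighbourhood of $\omega=0$: $(\mathcal S_D^{0,k})^{-1}=\mathcal S_0^{-1}+\omega\mathcal S_1^{-1}+\mathcal O(\omega^2)$ in operator norm. Then $C^1\in\mathbb C^{N\times N}$ is defined by $C^1_{ij}=-\langle\mathcal S_1^{-1}[\chi_{\partial D_j}],1\rangle_{\partial D_i}$. *)

theory Defs
  imports "HOL-Analysis.Analysis"
begin

section \<open>Surface measure\<close>

definition hausdorff_outer :: "nat \<Rightarrow> 'a::euclidean_space set \<Rightarrow> ennreal" where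
  "hausdorff_outer s A =
     (SUP \<delta>\<in>{0<..}.
        INF U\<in>{U :: nat \<Rightarrow> 'a set. A \<subseteq> (\<Union>i. U i) \<and> (\<forall>i. bounded (U i) \<and> diameter (U i) \<le> \<delta>)}.
          (\<Sum>i. ennreal (unit_ball_vol (real s) * (diameter (U i) / 2) ^ s)))"

text \<open>The outer measure above is a metric outer measure, hence countably additive on Borel sets;
  with this normalisation its restriction to a \<open>C\<^sup>1\<close> hypersurface, for \<open>s = d - 1\<close>, is the
  usual surface measure \<open>\<sigma>\<close>.\<close>

definition hausdorff_measure :: "nat \<Rightarrow> 'a::euclidean_space measure" where
  "hausdorff_measure s = measure_of UNIV (sets borel) (hausdorff_outer s)"

definition surface_measure :: "'a::euclidean_space set \<Rightarrow> 'a measure" where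
  "surface_measure \<Gamma> = restrict_space (hausdorff_measure (DIM('a) - 1)) \<Gamma>"


section \<open>Function spaces on a boundary\<close>

text \<open>Elements of the function spaces are represented by complex-valued functions, and two
  representatives are identified when the norm of their difference vanishes.\<close>

definition L2_space :: "'a::euclidean_space set \<Rightarrow> ('a \<Rightarrow> complex) set" where
  "L2_space \<Gamma> = {g \<in> borel_measurable (surface_measure \<Gamma>).
     (\<integral>\<^sup>+x. ennreal ((cmod (g x))\<^sup>2) \<partial>surface_measure \<Gamma>) < \<infinity>}"

text \<open>Squared Sobolev--Slobodeckij norm of order \<open>1/2\<close> on a \<open>(d - 1)\<close>-dimensional surface;
  the exponent of the kernel is \<open>(d - 1) + 2 \<sqdot> (1/2) = d\<close>.\<close>

definition H_half_sq :: "'a::euclidean_space set \<Rightarrow> ('a \<Rightarrow> complex) \<Rightarrow> ennreal" where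
  "H_half_sq \<Gamma> u =
     (\<integral>\<^sup>+x. ennreal ((cmod (u x))\<^sup>2) \<partial>surface_measure \<Gamma>) +
     (\<integral>\<^sup>+x. \<integral>\<^sup>+y. ennreal ((cmod (u x - u y))\<^sup>2 / dist x y ^ DIM('a))
        \<partial>surface_measure \<Gamma> \<partial>surface_measure \<Gamma>)"

definition H_half :: "'a::euclidean_space set \<Rightarrow> ('a \<Rightarrow> complex) set" where
  "H_half \<Gamma> = {u \<in> borel_measurable (surface_measure \<Gamma>). H_half_sq \<Gamma> u < \<infinity>}"

definition H_half_norm :: "'a::euclidean_space set \<Rightarrow> ('a \<Rightarrow> complex) \<Rightarrow> real" where
  "H_half_norm \<Gamma> u = sqrt (enn2real (H_half_sq \<Gamma> u))"

text \<open>\<open>H\<^sup>-\<^sup>1\<^sup>/\<^sup>2\<close> is the antidual of \<open>H\<^sup>1\<^sup>/\<^sup>2\<close>: the functional \<open>\<psi>\<close> sends \<open>\<phi>\<close> to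
  \<open>\<langle>\<psi>, \<phi>\<rangle>\<close>, the extension of the pairing \<open>\<integral> \<psi> (cnj \<phi>) d\<sigma>\<close>, which is conjugate linear in \<open>\<phi>\<close>.\<close>

definition H_mhalf :: "'a::euclidean_space set \<Rightarrow> (('a \<Rightarrow> complex) \<Rightarrow> complex) set" where
  "H_mhalf \<Gamma> = {\<psi>.
     (\<forall>u\<in>H_half \<Gamma>. \<forall>v\<in>H_half \<Gamma>. \<psi> (\<lambda>x. u x + v x) = \<psi> u + \<psi> v) \<and>
     (\<forall>a. \<forall>u\<in>H_half \<Gamma>. \<psi> (\<lambda>x. a * u x) = cnj a * \<psi> u) \<and>
     (\<exists>K. \<forall>u\<in>H_half \<Gamma>. cmod (\<psi> u) \<le> K * H_half_norm \<Gamma> u)}"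

definition H_mhalf_norm :: "'a::euclidean_space set \<Rightarrow> (('a \<Rightarrow> complex) \<Rightarrow> complex) \<Rightarrow> real" where
  "H_mhalf_norm \<Gamma> \<psi> = (SUP u\<in>{u \<in> H_half \<Gamma>. H_half_norm \<Gamma> u \<le> 1}. cmod (\<psi> u))"

definition of_density ::
    "'a::euclidean_space set \<Rightarrow> ('a \<Rightarrow> complex) \<Rightarrow> (('a \<Rightarrow> complex) \<Rightarrow> complex)" where
  "of_density \<Gamma> g = (\<lambda>\<phi>. LINT x|surface_measure \<Gamma>. g x * cnj (\<phi> x))"

text \<open>\<open>\<langle>\<psi>, \<phi>\<rangle>\<close> over a part \<open>\<Gamma>'\<close> of the surface on which the functional \<open>\<psi>\<close> lives; for a density
  \<open>g\<close> this is \<open>\<integral>\<^bsub>\<Gamma>'\<^esub> g (cnj \<phi>) d\<sigma>\<close>.\<close>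

definition pairing_on ::
    "'a::euclidean_space set \<Rightarrow> (('a \<Rightarrow> complex) \<Rightarrow> complex) \<Rightarrow> ('a \<Rightarrow> complex) \<Rightarrow> complex" where
  "pairing_on \<Gamma>' \<psi> \<phi> = \<psi> (\<lambda>x. indicator \<Gamma>' x * \<phi> x)"


section \<open>Bounded operators between spaces of functions\<close>

definition bounded_op ::
    "('x \<Rightarrow> complex) set \<Rightarrow> (('x \<Rightarrow> complex) \<Rightarrow> real) \<Rightarrow>
     ('y \<Rightarrow> complex) set \<Rightarrow> (('y \<Rightarrow> complex) \<Rightarrow> real) \<Rightarrow>
     (('x \<Rightarrow> complex) \<Rightarrow> ('y \<Rightarrow> complex)) \<Rightarrow> bool" where
  "bounded_op A normA B normB S \<longleftrightarrow>
     S \<in> A \<rightarrow> B \<and>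
     (\<forall>f\<in>A. \<forall>g\<in>A. normB (\<lambda>y. S (\<lambda>x. f x + g x) y - (S f y + S g y)) = 0) \<and>
     (\<forall>a. \<forall>f\<in>A. normB (\<lambda>y. S (\<lambda>x. a * f x) y - a * S f y) = 0) \<and>
     (\<exists>K. \<forall>f\<in>A. normB (S f) \<le> K * normA f)"

definition inverse_ops ::
    "('x \<Rightarrow> complex) set \<Rightarrow> (('x \<Rightarrow> complex) \<Rightarrow> real) \<Rightarrow>
     ('y \<Rightarrow> complex) set \<Rightarrow> (('y \<Rightarrow> complex) \<Rightarrow> real) \<Rightarrow>
     (('x \<Rightarrow> complex) \<Rightarrow> ('y \<Rightarrow> complex)) \<Rightarrow> (('y \<Rightarrow> complex) \<Rightarrow> ('x \<Rightarrow> complex)) \<Rightarrow> bool" where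
  "inverse_ops A normA B normB S T \<longleftrightarrow>
     (\<forall>f\<in>A. normA (\<lambda>x. T (S f) x - f x) = 0) \<and>
     (\<forall>g\<in>B. normB (\<lambda>y. S (T g) y - g y) = 0)"


section \<open>Periodic resonators\<close>

text \<open>A point \<open>x = (x\<^sub>\<ell>, x\<^sub>d)\<close> of \<open>\<real>\<^sup>d\<close> is a pair in \<open>(real ^ 'n) \<times> real\<close>, so \<open>d = CARD('n) + 1\<close>.\<close>

type_synonym 'n point = "(real ^ 'n) \<times> real"
type_synonym 'n wave = "'n point \<Rightarrow> complex"
type_synonym 'n dual_wave = "'n wave \<Rightarrow> complex"

definition lattice :: "real \<Rightarrow> (real ^ 'n) set" where
  "lattice a = range (\<lambda>m :: 'n \<Rightarrow> int. \<chi> i. a * of_int (m i))"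

definition strip :: "real \<Rightarrow> 'n::finite point set" where
  "strip L = {x. \<forall>i. - L / 2 \<le> fst x $ i \<and> fst x $ i \<le> L / 2}"

definition C2_function :: "(real ^ 'n \<Rightarrow> real) \<Rightarrow> bool" where
  "C2_function \<gamma> \<longleftrightarrow>
     (\<exists>(\<gamma>' :: real ^ 'n \<Rightarrow> ((real ^ 'n) \<Rightarrow>\<^sub>L real))
        (\<gamma>'' :: real ^ 'n \<Rightarrow> ((real ^ 'n) \<Rightarrow>\<^sub>L ((real ^ 'n) \<Rightarrow>\<^sub>L real))).
        (\<forall>y. (\<gamma> has_derivative blinfun_apply (\<gamma>' y)) (at y)) \<and>
        (\<forall>y. (\<gamma>' has_derivative blinfun_apply (\<gamma>'' y)) (at y)) \<and>
        continuous_on UNIV \<gamma>'')"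

text \<open>Near each boundary point and after a rigid motion, the set is the part of a ball above the
  graph of a \<open>C\<^sup>2\<close> function (a translation can be absorbed into \<open>\<gamma>\<close>).\<close>

definition C2_boundary :: "'n::finite point set \<Rightarrow> bool" where
  "C2_boundary U \<longleftrightarrow>
     (\<forall>p\<in>frontier U. \<exists>r>0. \<exists>(T :: 'n point \<Rightarrow> 'n point) \<gamma>.
        orthogonal_transformation T \<and> C2_function \<gamma> \<and>
        U \<inter> ball p r = {x \<in> ball p r. snd (T x) > \<gamma> (fst (T x))})"

definition resonators :: "real \<Rightarrow> ('m::finite \<Rightarrow> 'n::finite point set) \<Rightarrow> bool" where
  "resonators L D \<longleftrightarrow>
     (\<forall>i. D i \<noteq> {} \<and> bounded (D i) \<and> connected (D i) \<and> open (D i) \<and>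
          C2_boundary (D i) \<and> D i \<subseteq> strip L) \<and>
     (\<forall>i j. \<forall>a\<in>lattice L. \<forall>b\<in>lattice L. (i, a) \<noteq> (j, b) \<longrightarrow>
        (\<lambda>x. x + (a, 0)) ` closure (D i) \<inter> (\<lambda>x. x + (b, 0)) ` closure (D j) = {})"

definition R_refl :: "'n::finite point \<Rightarrow> 'n point" where
  "R_refl x = (- fst x, snd x)"

definition refl_perm :: "('m \<Rightarrow> 'n::finite point set) \<Rightarrow> 'm \<Rightarrow> 'm" where
  "refl_perm D i = (THE j. R_refl ` D i = D j)"

definition Pi_matrix :: "('m::finite \<Rightarrow> 'n::finite point set) \<Rightarrow> complex ^ 'm ^ 'm" where
  "Pi_matrix D = (\<chi> i j. if j = refl_perm D i then 1 else 0)"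


section \<open>Periodic Green's function\<close>

text \<open>For \<open>|k| < 2\<pi>/L \<le> |\<eta>|\<close> the real part of \<open>|\<eta>|\<^sup>2 - k\<^sup>2\<close> is positive, so the formula for
  \<open>\<eta> \<noteq> 0\<close> is the branch of the square root of \<open>k\<^sup>2 - |\<eta>|\<^sup>2\<close> that is holomorphic in \<open>k\<close> and
  equals \<open>\<i>|\<eta>|\<close> at \<open>k = 0\<close>; see the lemma \<open>beta_branch\<close> below.\<close>

definition beta :: "complex \<Rightarrow> real ^ 'n \<Rightarrow> complex" where
  "beta k \<eta> = (if \<eta> = 0 then k else \<i> * csqrt (of_real ((norm \<eta>)\<^sup>2) - k\<^sup>2))"

lemma beta_branch:
  fixes \<eta> :: "real ^ 'n"
  assumes "\<eta> \<noteq> 0"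
  shows "(\<lambda>k. beta k \<eta>) holomorphic_on ball 0 (norm \<eta>)"
    and "(beta k \<eta>)\<^sup>2 = k\<^sup>2 - of_real ((norm \<eta>)\<^sup>2)"
    and "beta 0 \<eta> = \<i> * of_real (norm \<eta>)"
proof -
  have "of_real ((norm \<eta>)\<^sup>2) - k\<^sup>2 \<notin> \<real>\<^sub>\<le>\<^sub>0" if "k \<in> ball 0 (norm \<eta>)" for k :: complex
  proof -
    have "(cmod k)\<^sup>2 < (norm \<eta>)\<^sup>2"
      using that by (intro power_strict_mono) auto
    moreover have "Re (k\<^sup>2) \<le> (cmod k)\<^sup>2"
      using complex_Re_le_cmod[of "k\<^sup>2"] by (simp add: norm_power)
    ultimately show ?thesis
      by (auto simp: complex_nonpos_Reals_iff)
  qed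
  then show "(\<lambda>k. beta k \<eta>) holomorphic_on ball 0 (norm \<eta>)"
    using assms unfolding beta_def by (auto intro!: holomorphic_intros)
  show "(beta k \<eta>)\<^sup>2 = k\<^sup>2 - of_real ((norm \<eta>)\<^sup>2)"
    using assms by (simp add: beta_def power_mult_distrib)
  show "beta 0 \<eta> = \<i> * of_real (norm \<eta>)"
    using assms by (simp add: beta_def flip: of_real_power)
qed

definition green_mode :: "real \<Rightarrow> complex \<Rightarrow> real ^ 'n \<Rightarrow> 'n point \<Rightarrow> complex" where
  "green_mode L k \<eta> x =
     exp (\<i> * of_real (\<eta> \<bullet> fst x)) * exp (\<i> * beta k \<eta> * of_real \<bar>snd x\<bar>)
     / (2 * of_real (L ^ CARD('n)) * \<i> * beta k \<eta>)"

text \<open>The series over the dual lattice converges absolutely only off the plane \<open>x\<^sub>d = 0\<close>, which the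
  differences of boundary points may meet. On that plane its value is the limit
  \<open>x\<^sub>d \<rightarrow> 0\<close>, i.e. the Green's function is extended continuously (away from its poles at
  \<open>lattice L \<times> {0}\<close>). The zero mode is continuous across the plane and is written separately.\<close>

definition green :: "real \<Rightarrow> complex \<Rightarrow> 'n::finite point \<Rightarrow> complex" where
  "green L k x = green_mode L k 0 x +
     (let F = (\<lambda>t. \<Sum>\<^sub>\<infinity>\<eta>\<in>lattice (2 * pi / L) - {0}. green_mode L k \<eta> (fst x, t))
      in if snd x \<noteq> 0 then F (snd x) else Lim (at 0) F)"


section \<open>Single layer operator and first-order capacitance matrix\<close>

text \<open>The single layer operator is the bounded operator \<open>H\<^sup>-\<^sup>1\<^sup>/\<^sup>2 \<rightarrow> H\<^sup>1\<^sup>/\<^sup>2\<close> that is given by the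
  integral formula on square integrable densities; these are dense in \<open>H\<^sup>-\<^sup>1\<^sup>/\<^sup>2\<close>, so it is unique.\<close>

definition single_layer ::
    "real \<Rightarrow> 'n::finite point set \<Rightarrow> complex \<Rightarrow>
     ('n dual_wave \<Rightarrow> 'n wave) \<Rightarrow> bool" where
  "single_layer L \<Gamma> k S \<longleftrightarrow>
     bounded_op (H_mhalf \<Gamma>) (H_mhalf_norm \<Gamma>) (H_half \<Gamma>) (H_half_norm \<Gamma>) S \<and>
     (\<forall>g\<in>L2_space \<Gamma>. AE x in surface_measure \<Gamma>.
        S (of_density \<Gamma> g) x = (LINT y|surface_measure \<Gamma>. green L k (x - y) * g y))"

text \<open>\<open>S0\<close> and \<open>S1\<close> are the coefficients \<open>\<S>\<^sub>0\<^sup>-\<^sup>1\<close> and \<open>\<S>\<^sub>1\<^sup>-\<^sup>1\<close> in the expansion of the inverse of the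
  single layer operator at wavenumber \<open>k = \<omega>/c\<close>, up to \<open>O(\<omega>\<^sup>2)\<close> in operator norm.\<close>

definition inverse_expansion ::
    "real \<Rightarrow> real \<Rightarrow> 'n::finite point set \<Rightarrow>
     ('n wave \<Rightarrow> 'n dual_wave) \<Rightarrow> ('n wave \<Rightarrow> 'n dual_wave) \<Rightarrow> bool" where
  "inverse_expansion L c \<Gamma> S0 S1 \<longleftrightarrow>
     bounded_op (H_half \<Gamma>) (H_half_norm \<Gamma>) (H_mhalf \<Gamma>) (H_mhalf_norm \<Gamma>) S0 \<and>
     bounded_op (H_half \<Gamma>) (H_half_norm \<Gamma>) (H_mhalf \<Gamma>) (H_mhalf_norm \<Gamma>) S1 \<and>
     (\<exists>K. \<forall>\<^sub>F \<omega> in at 0. \<exists>S T.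
        single_layer L \<Gamma> (\<omega> / of_real c) S \<and>
        bounded_op (H_half \<Gamma>) (H_half_norm \<Gamma>) (H_mhalf \<Gamma>) (H_mhalf_norm \<Gamma>) T \<and>
        inverse_ops (H_mhalf \<Gamma>) (H_mhalf_norm \<Gamma>) (H_half \<Gamma>) (H_half_norm \<Gamma>) S T \<and>
        (\<forall>\<phi>\<in>H_half \<Gamma>. H_mhalf_norm \<Gamma> (\<lambda>v. T \<phi> v - (S0 \<phi> v + \<omega> * S1 \<phi> v))
           \<le> K * (cmod \<omega>)\<^sup>2 * H_half_norm \<Gamma> \<phi>))"

definition C1_matrix ::
    "('m::finite \<Rightarrow> 'n::finite point set) \<Rightarrow>
     ('n wave \<Rightarrow> 'n dual_wave) \<Rightarrow> complex ^ 'm ^ 'm" where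
  "C1_matrix D S1 =
     (\<chi> i j. - pairing_on (frontier (D i)) (S1 (indicator (frontier (D j)))) (\<lambda>_. 1))"

end

(* The Green's function at k and at -k differ only in the zero mode, that is, by a function of
   x_d alone, because the evanescent modes depend on k^2. Such a kernel annihilates densities that
   are odd under the reflection R, so the single layer operators at omega and -omega agree on odd
   densities, and by density of L^2 in H^(-1/2) on odd functionals. Since the operators commute
   with R, the function phi = sum_j q_j chi_j, odd because Pi q = -q, has the same preimage under
   both, whence 2 omega S_1^(-1) phi = O(omega^2) and S_1^(-1) phi = 0. No expansion or convergence
   property of the Green's function enters. *)

theory Submission
  imports Defs
begin

section \<open>Surface measure of a boundary of class C2\<close>

text \<open>Elements of the function spaces are plain functions, and two of them count as equal only
  when their difference has norm zero. Operator identities are therefore read almost everywhere on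
  the surface or, for functionals, at test functions in \<open>H_half\<close> only; boundedness
  makes an operator insensitive to the choice of representative.

  The integral formula describes a single layer operator only on square integrable densities,
  whereas the preimage of \<phi> is a general functional. The density statement bridging this gap
  starts from a near minimiser w of the Riesz energy: the functional v -> (w, v) of H^(1/2) becomes
  a square integrable density once the singular kernel is cut off near the diagonal, at an
  arbitrarily small cost in the dual norm.

  Integrals against the Green's function undergo only changes of variables and the addition of an
  integrable term, and both respect the default value 0 of a non-integrable integrand. Finiteness of
  the surface measure, where the C2 graphs enter, makes bounded functions square integrable and
  gives Fubini on the surface.\<close>

lemma sets_hausdorff_measure [simp, measurable_cong]: "sets (hausdorff_measure s) = sets borel"
  unfolding hausdorff_measure_def
  by (metis (no_types) sets_measure_of space_borel sets.sigma_sets_eq subset_UNIV sets.space_closed)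

lemma space_hausdorff_measure [simp]: "space (hausdorff_measure s) = UNIV"
  using sets_eq_imp_space_eq[OF sets_hausdorff_measure] by simp

text \<open>\<open>measure_of\<close> collapses to the zero measure unless its set function is
  countably additive, and the formula keeps both alternatives. Invariance under isometries and the
  upper bound by the outer measure are true in each of them.\<close>

lemma emeasure_hausdorff_measure:
  fixes A :: "'a::euclidean_space set"
  assumes "A \<in> sets borel"
  shows "emeasure (hausdorff_measure s) A =
    (if measure_space UNIV (sets borel) (hausdorff_outer s :: 'a set \<Rightarrow> _)
     then hausdorff_outer s A else 0)"
proof -
  have eq: "sigma_sets UNIV (sets (borel :: 'a measure)) = sets borel"
    by (metis space_borel sets.sigma_sets_eq)
  show ?thesis
    using assms unfolding hausdorff_measure_def emeasure_measure_of_conv eq by simp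
qed

lemma space_surface_measure [simp]: "space (surface_measure \<Gamma>) = \<Gamma>"
  by (simp add: surface_measure_def space_restrict_space)

lemma sets_surface_measure:
  "sets (surface_measure \<Gamma>) = sets (restrict_space borel \<Gamma>)"
  by (simp add: surface_measure_def sets_restrict_space)

lemma emeasure_surface_measure_space:
  assumes "\<Gamma> \<in> sets borel"
  shows "emeasure (surface_measure (\<Gamma> :: 'a::euclidean_space set)) \<Gamma>
    = emeasure (hausdorff_measure (DIM('a) - 1)) \<Gamma>"
  using assms by (simp add: surface_measure_def emeasure_restrict_space)

section \<open>Invariance of the surface measure under isometric involutions\<close>

lemma diameter_image_isometry:
  assumes "\<And>x y. dist (f x) (f y) = dist x y"
  shows "diameter (f ` A) = diameter A"
proof -
  have "(\<lambda>(x, y). dist x y) ` (f ` A \<times> f ` A) = (\<lambda>(x, y). dist x y) ` (A \<times> A)"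
    using assms by (force simp: image_iff)
  then show ?thesis by (simp add: diameter_def)
qed

lemma bounded_image_isometry:
  assumes "\<And>x y. dist (f x) (f y) = dist x y" "bounded A"
  shows "bounded (f ` A)"
proof -
  obtain x e where "\<forall>y\<in>A. dist x y \<le> e" using assms(2) unfolding bounded_def by blast
  then show ?thesis using assms(1) unfolding bounded_def by (intro exI[of _ "f x"] exI[of _ e]) auto
qed

text \<open>The image of an admissible cover is an admissible cover of the image with the same
  diameters. For an involution, applying the inequality twice gives equality.\<close>

lemma hausdorff_outer_image_le:
  assumes "\<And>x y. dist (f x) (f y) = dist x y"
  shows "hausdorff_outer s (f ` A) \<le> hausdorff_outer s A"
  unfolding hausdorff_outer_def
proof (rule SUP_mono)
  fix \<delta> :: real assume \<delta>: "\<delta> \<in> {0<..}"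
  have "(INF U\<in>{U. f ` A \<subseteq> (\<Union>i. U i) \<and> (\<forall>i. bounded (U i) \<and> diameter (U i) \<le> \<delta>)}.
          \<Sum>i. ennreal (unit_ball_vol (real s) * (diameter (U i) / 2) ^ s))
     \<le> (INF U\<in>{U. A \<subseteq> (\<Union>i. U i) \<and> (\<forall>i. bounded (U i) \<and> diameter (U i) \<le> \<delta>)}.
          \<Sum>i. ennreal (unit_ball_vol (real s) * (diameter (U i) / 2) ^ s))"
  proof (rule INF_mono)
    fix U assume U: "U \<in> {U. A \<subseteq> (\<Union>i::nat. U i) \<and> (\<forall>i. bounded (U i) \<and> diameter (U i) \<le> \<delta>)}"
    show "\<exists>V\<in>{U. f ` A \<subseteq> (\<Union>i. U i) \<and> (\<forall>i. bounded (U i) \<and> diameter (U i) \<le> \<delta>)}.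
      (\<Sum>i. ennreal (unit_ball_vol (real s) * (diameter (V i) / 2) ^ s))
      \<le> (\<Sum>i. ennreal (unit_ball_vol (real s) * (diameter (U i) / 2) ^ s))"
    proof (intro bexI[of _ "\<lambda>i. f ` U i"])
      have "f ` A \<subseteq> (\<Union>i. f ` U i)" using U by blast
      then show "(\<lambda>i. f ` U i) \<in> {U. f ` A \<subseteq> (\<Union>i. U i) \<and> (\<forall>i. bounded (U i) \<and> diameter (U i) \<le> \<delta>)}"
        using U diameter_image_isometry[OF assms] bounded_image_isometry[OF assms] by auto
    qed (simp add: diameter_image_isometry[OF assms])
  qed
  then show "\<exists>m\<in>{0<..}. (INF U\<in>{U. f ` A \<subseteq> (\<Union>i. U i) \<and> (\<forall>i. bounded (U i) \<and> diameter (U i) \<le> \<delta>)}.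
          \<Sum>i. ennreal (unit_ball_vol (real s) * (diameter (U i) / 2) ^ s))
     \<le> (INF U\<in>{U. A \<subseteq> (\<Union>i. U i) \<and> (\<forall>i. bounded (U i) \<and> diameter (U i) \<le> m)}.
          \<Sum>i. ennreal (unit_ball_vol (real s) * (diameter (U i) / 2) ^ s))"
    using \<delta> by blast
qed

text \<open>Preimages under an involution are images, so the invariance of the outer measure passes
  to the push-forward. In the \<open>distr\<close> form it yields changes of variables in integrals
  and almost-everywhere statements.\<close>

lemma distr_surface_measure_isometry:
  fixes f :: "'a::euclidean_space \<Rightarrow> 'a"
  assumes iso: "\<And>x y. dist (f x) (f y) = dist x y" and inv: "\<And>x. f (f x) = x"
    and \<Gamma>: "f ` \<Gamma> = \<Gamma>" "\<Gamma> \<in> sets borel"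
  shows "f \<in> measurable (surface_measure \<Gamma>) (surface_measure \<Gamma>)"
    and "distr (surface_measure \<Gamma>) (surface_measure \<Gamma>) f = surface_measure \<Gamma>"
proof -
  have "continuous_on UNIV f"
    unfolding continuous_on_iff using iso by auto
  then have f[measurable]: "f \<in> borel \<rightarrow>\<^sub>M borel"
    by (rule borel_measurable_continuous_onI)
  show meas: "f \<in> measurable (surface_measure \<Gamma>) (surface_measure \<Gamma>)"
  proof -
    have "f \<in> restrict_space borel \<Gamma> \<rightarrow>\<^sub>M restrict_space borel \<Gamma>"
      using \<Gamma>(1) by (intro measurable_restrict_space2 measurable_restrict_space1 f)
        (auto simp: space_restrict_space)
    then show ?thesis
      by (simp cong: measurable_cong_sets add: sets_surface_measure)
  qed
  have image: "f -` A = f ` A" for A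
    using inv by (metis bij_betw_def bij_def inj_def inv_equality bij_vimage_eq_inv_image o_bij surj_def involuntory_imp_bij)
  have outer: "hausdorff_outer s (f ` A) = hausdorff_outer s A" for s A
    using hausdorff_outer_image_le[of f s A, OF iso] hausdorff_outer_image_le[of f s "f ` A", OF iso]
    by (simp add: image_image inv)
  have borel: "f ` A \<in> sets borel" if "A \<in> sets borel" for A
    using measurable_sets[OF f that] by (simp add: image)
  have eq: "emeasure (hausdorff_measure s) (f ` A) = emeasure (hausdorff_measure s) A"
    if "A \<in> sets borel" for s A
    using that borel[OF that] by (simp add: emeasure_hausdorff_measure outer)
  show "distr (surface_measure \<Gamma>) (surface_measure \<Gamma>) f = surface_measure \<Gamma>"
  proof (rule measure_eqI)
    fix A assume "A \<in> sets (distr (surface_measure \<Gamma>) (surface_measure \<Gamma>) f)"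
    then have A: "A \<in> sets (surface_measure \<Gamma>)" "A \<subseteq> \<Gamma>" "A \<in> sets borel"
      using \<Gamma>(2) sets.sets_into_space[of A "surface_measure \<Gamma>"]
      by (auto simp: sets_surface_measure sets_restrict_space_iff)
    have "f -` A \<inter> \<Gamma> = f ` A"
      using A(2) \<Gamma>(1) by (auto simp: image)
    then have "emeasure (distr (surface_measure \<Gamma>) (surface_measure \<Gamma>) f) A
      = emeasure (surface_measure \<Gamma>) (f ` A)"
      using A by (simp add: emeasure_distr[OF meas])
    also have "\<dots> = emeasure (surface_measure \<Gamma>) A"
      using A \<Gamma> eq[of A] image_mono[of A \<Gamma> f]
      by (simp add: surface_measure_def emeasure_restrict_space)
    finally show "emeasure (distr (surface_measure \<Gamma>) (surface_measure \<Gamma>) f) A = emeasure (surface_measure \<Gamma>) A" .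
  qed simp
qed

section \<open>Finiteness of the surface measure of a compact C2 boundary\<close>

text \<open>A cube of dimension n cut into cells of side h has about (2 a / h)^n of them, and the
  image of each has diameter at most C n h. The powers of h cancel, so the covering sums stay
  bounded as h tends to 0.\<close>

lemma hausdorff_outer_lipschitz_cube:
  fixes f :: "real ^ 'n::finite \<Rightarrow> 'a::euclidean_space"
  assumes lip: "\<And>x y. x \<in> B \<Longrightarrow> y \<in> B \<Longrightarrow> dist (f x) (f y) \<le> C * dist x y"
    and B: "\<And>x i. x \<in> B \<Longrightarrow> \<bar>x $ i\<bar> \<le> a" and "C \<ge> 0" "a > 0"
  shows "hausdorff_outer CARD('n) (f ` B) < \<infinity>"
proof -
  \<comment> \<open>The base of the power is (N + 1) C n h / 2 with (N + 1) h replaced by its bound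
    4 a, which follows from N h = 2 a and N \<ge> 1.\<close>
  define K where "K = unit_ball_vol (real CARD('n)) * (2 * C * real CARD('n) * a) ^ CARD('n)"
  have "hausdorff_outer CARD('n) (f ` B) \<le> ennreal K"
    unfolding hausdorff_outer_def
  proof (rule SUP_least)
    fix \<delta> :: real assume "\<delta> \<in> {0<..}"
    then have \<delta>: "\<delta> > 0" by simp
    obtain N0 :: nat where N0: "C * real CARD('n) * (2 * a) / \<delta> < real N0"
      using reals_Archimedean2 by blast
    define N where "N = Suc N0"
    have N: "N > 0" "C * real CARD('n) * (2 * a) / real N \<le> \<delta>"
      using N0 \<delta> by (auto simp: N_def field_simps)
    define h where "h = 2 * a / real N"
    have h: "h > 0" using N assms by (simp add: h_def)
    define cell :: "('n \<Rightarrow> nat) \<Rightarrow> (real ^ 'n) set" where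
      "cell m = {x \<in> B. \<forall>i. real (m i) * h \<le> x $ i + a \<and> x $ i + a \<le> (real (m i) + 1) * h}" for m
    \<comment> \<open>Each index runs over 0, ..., N, one value more than there are cells along an
      edge: a coordinate equal to a has floor exactly N.\<close>
    define I :: "('n \<Rightarrow> nat) set" where "I = PiE UNIV (\<lambda>_. {..<N + 1})"
    have finI: "finite I"
      unfolding I_def by (intro finite_PiE) auto
    have cardI: "card I = (N + 1) ^ CARD('n)"
      unfolding I_def by (simp add: card_PiE)
    obtain g where g: "bij_betw g {..<card I} I"
      using ex_bij_betw_nat_finite[OF finI] by (auto simp: atLeast0LessThan)
    \<comment> \<open>Beyond \<open>card I\<close> the sets are empty and have diameter 0. As the
      exponent \<open>CARD('n)\<close> is positive, their terms vanish and the series is a finite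
      sum.\<close>
    define U where "U i = (if i < card I then f ` cell (g i) else {})" for i
    have cell_dist: "dist (f x) (f y) \<le> C * (real CARD('n) * h)"
      if "x \<in> cell m" "y \<in> cell m" for x y m
    proof -
      have "\<bar>x $ i - y $ i\<bar> \<le> h" for i
      proof -
        have "real (m i) * h \<le> x $ i + a \<and> x $ i + a \<le> (real (m i) + 1) * h"
          "real (m i) * h \<le> y $ i + a \<and> y $ i + a \<le> (real (m i) + 1) * h"
          using that by (auto simp: cell_def)
        moreover have "(real (m i) + 1) * h = real (m i) * h + h" by (simp add: algebra_simps)
        ultimately show ?thesis by linarith
      qed
      then have "(\<Sum>i\<in>UNIV. \<bar>(x - y) $ i\<bar>) \<le> real CARD('n) * h"
        using sum_mono[of UNIV "\<lambda>i. \<bar>(x - y) $ i\<bar>" "\<lambda>_. h"] by simp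
      then have "dist x y \<le> real CARD('n) * h"
        using norm_le_l1_cart[of "x - y"] by (simp add: dist_norm)
      then show ?thesis
        using lip[of x y] that mult_left_mono[OF _ \<open>C \<ge> 0\<close>, of "dist x y"]
        by (fastforce simp: cell_def)
    qed
    have diam: "diameter (U i) \<le> C * (real CARD('n) * h)" for i
      using cell_dist h \<open>C \<ge> 0\<close> by (intro diameter_le) (auto simp: U_def dist_norm split: if_splits)
    have bnd: "bounded (U i)" for i
      unfolding bounded_two_points
      by (intro exI[of _ "C * (real CARD('n) * h)"]) (use cell_dist in \<open>auto simp: U_def split: if_splits\<close>)
    have Nh: "real N * h = 2 * a" using N by (simp add: h_def)
    have cover: "f ` B \<subseteq> (\<Union>i. U i)"
    proof
      fix z assume "z \<in> f ` B"
      then obtain x where x: "x \<in> B" "z = f x" by blast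
      define m where "m i = nat \<lfloor>(x $ i + a) / h\<rfloor>" for i
      have pos: "0 \<le> x $ i + a" "x $ i + a \<le> real N * h" for i
        using B[OF x(1), of i] Nh by linarith+
      have m: "real (m i) \<le> (x $ i + a) / h" "(x $ i + a) / h \<le> real (m i) + 1" for i
        using pos(1)[of i] h by (auto simp: m_def of_nat_nat le_floor_iff)
      have "m i < N + 1" for i
      proof -
        have "real (m i) \<le> real N"
          using order.trans[OF m(1)[of i], of "real N"] pos(2)[of i] h by (simp add: field_simps)
        then show ?thesis by simp
      qed
      then have "m \<in> I" by (auto simp: I_def)
      then have "m \<in> g ` {..<card I}"
        using g by (simp add: bij_betw_def)
      then obtain i where i: "i < card I" "g i = m" by auto
      have "x \<in> cell m"
        using x m h by (auto simp: cell_def field_simps)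
      then show "z \<in> (\<Union>i. U i)"
        using i x by (auto simp: U_def intro!: exI[of _ i])
    qed
    have small: "C * (real CARD('n) * h) \<le> \<delta>"
      using N(2) by (simp add: h_def mult_ac)
    have "(\<Sum>i. ennreal (unit_ball_vol (real CARD('n)) * (diameter (U i) / 2) ^ CARD('n)))
      = (\<Sum>i<card I. ennreal (unit_ball_vol (real CARD('n)) * (diameter (U i) / 2) ^ CARD('n)))"
      by (rule suminf_finite) (auto simp: U_def)
    also have "\<dots> \<le> (\<Sum>i<card I. ennreal (unit_ball_vol (real CARD('n)) * (C * (real CARD('n) * h) / 2) ^ CARD('n)))"
      using diam by (intro sum_mono ennreal_leI mult_left_mono power_mono divide_right_mono)
        (auto simp: diameter_ge_0 bnd)
    also have "\<dots> = ennreal (unit_ball_vol (real CARD('n)) * ((real N + 1) * (C * (real CARD('n) * h) / 2)) ^ CARD('n))"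
      unfolding power_mult_distrib[of "real N + 1"]
      by (simp add: cardI ennreal_of_nat_eq_real_of_nat ennreal_mult' [symmetric] mult.left_commute add.commute)
    also have "\<dots> \<le> ennreal K"
    proof -
      have "(real N + 1) * h \<le> 2 * real N * h"
        using N h by (intro mult_right_mono) auto
      then have "(real N + 1) * h \<le> 4 * a" using Nh by linarith
      then have "(real N + 1) * h * (C * real CARD('n) / 2) \<le> 4 * a * (C * real CARD('n) / 2)"
        using \<open>C \<ge> 0\<close> by (intro mult_right_mono) auto
      then have "(real N + 1) * (C * (real CARD('n) * h) / 2) \<le> 2 * C * real CARD('n) * a"
        by (simp add: mult_ac)
      then show ?thesis
        unfolding K_def using h \<open>C \<ge> 0\<close>
        by (intro ennreal_leI mult_left_mono power_mono) auto
    qed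
    finally show "(INF U\<in>{U. f ` B \<subseteq> (\<Union>i. U i) \<and> (\<forall>i. bounded (U i) \<and> diameter (U i) \<le> \<delta>)}.
          \<Sum>i. ennreal (unit_ball_vol (real CARD('n)) * (diameter (U i) / 2) ^ CARD('n))) \<le> ennreal K"
      by (intro INF_lower2[of U]) (use cover bnd order.trans[OF diam small] in auto)
  qed
  also have "\<dots> < \<infinity>" by simp
  finally show ?thesis .
qed

text \<open>The derivative is itself differentiable, hence continuous and bounded on the compact
  box; convexity of the box allows the mean value inequality.\<close>

lemma C2_function_lipschitz_on_cbox:
  fixes \<gamma> :: "real ^ 'n::finite \<Rightarrow> real"
  assumes "C2_function \<gamma>"
  obtains C where "C \<ge> 0"
    "\<And>x y. x \<in> cbox a b \<Longrightarrow> y \<in> cbox a b \<Longrightarrow> \<bar>\<gamma> x - \<gamma> y\<bar> \<le> C * norm (x - y)"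
proof -
  obtain \<gamma>' :: "real ^ 'n \<Rightarrow> ((real ^ 'n) \<Rightarrow>\<^sub>L real)"
    and \<gamma>'' :: "real ^ 'n \<Rightarrow> ((real ^ 'n) \<Rightarrow>\<^sub>L ((real ^ 'n) \<Rightarrow>\<^sub>L real))"
    where d: "\<And>y. (\<gamma> has_derivative blinfun_apply (\<gamma>' y)) (at y)"
      "\<And>y. (\<gamma>' has_derivative blinfun_apply (\<gamma>'' y)) (at y)"
    using assms unfolding C2_function_def by blast
  have "continuous_on (cbox a b) \<gamma>'"
    using has_derivative_continuous[OF d(2)] continuous_at_imp_continuous_on by blast
  then have "bounded (\<gamma>' ` cbox a b)"
    by (intro compact_imp_bounded compact_continuous_image compact_cbox)
  then obtain C where C: "C > 0" "\<And>x. x \<in> cbox a b \<Longrightarrow> norm (\<gamma>' x) \<le> C"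
    by (auto simp: bounded_pos)
  have "norm (\<gamma> x - \<gamma> y) \<le> C * norm (x - y)" if "x \<in> cbox a b" "y \<in> cbox a b" for x y
  proof (rule differentiable_bound[OF convex_box(1)])
    show "(\<gamma> has_derivative blinfun_apply (\<gamma>' z)) (at z within cbox a b)" for z
      using d(1) has_derivative_at_withinI by blast
    show "onorm (blinfun_apply (\<gamma>' z)) \<le> C" if "z \<in> cbox a b" for z
      using C(2)[OF that] by (simp add: norm_blinfun.rep_eq)
  qed (use that in auto)
  with C show thesis by (intro that[of C]) auto
qed

text \<open>A frontier point of an open set lies outside it, hence not above the graph. Strictly
  below the graph it would have a neighbourhood that misses U.\<close>

lemma frontier_graph_subset:
  fixes T :: "'n::finite point \<Rightarrow> 'n point"
  assumes "open U" "continuous_on UNIV T" "continuous_on UNIV \<gamma>"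
    and eq: "U \<inter> ball p r = {x \<in> ball p r. snd (T x) > \<gamma> (fst (T x))}"
  shows "frontier U \<inter> ball p r \<subseteq> {x \<in> ball p r. snd (T x) = \<gamma> (fst (T x))}"
proof
  have iff: "z \<in> U \<longleftrightarrow> snd (T z) > \<gamma> (fst (T z))" if "z \<in> ball p r" for z
    using eq that by blast
  fix x assume x: "x \<in> frontier U \<inter> ball p r"
  have "x \<notin> U" using x assms(1) frontier_disjoint_eq[of U] by blast
  then have le: "snd (T x) \<le> \<gamma> (fst (T x))" using x iff[of x] by simp
  have "\<not> snd (T x) < \<gamma> (fst (T x))"
  proof
    assume lt: "snd (T x) < \<gamma> (fst (T x))"
    define V where "V = ball p r \<inter> {x. snd (T x) < \<gamma> (fst (T x))}"
    have "continuous_on UNIV (\<lambda>x. \<gamma> (fst (T x)))"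
      by (rule continuous_on_compose2[OF assms(3)]) (auto intro!: continuous_intros assms(2))
    then have "open V"
      unfolding V_def using assms(2)
      by (intro open_Int open_ball open_Collect_less continuous_intros) auto
    moreover have "x \<in> V" "x \<in> closure U" using x lt by (auto simp: V_def frontier_def)
    ultimately obtain z where "z \<in> U" "z \<in> V"
      by (meson closure_iff_nhds_not_empty order_refl disjoint_iff)
    then show False using iff[of z] by (auto simp: V_def)
  qed
  then show "x \<in> {x \<in> ball p r. snd (T x) = \<gamma> (fst (T x))}" using le x by simp
qed

text \<open>The piece of graph is the image of its bounded projection B under z -> T^(-1) (z,
  \<gamma> z), which is Lipschitz with constant 1 + C because the inverse of T is an
  isometry.\<close>

lemma hausdorff_outer_C2_graph_finite:
  fixes T :: "'n::finite point \<Rightarrow> 'n point"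
  assumes T: "orthogonal_transformation T" and \<gamma>: "C2_function \<gamma>"
  shows "hausdorff_outer CARD('n) {x \<in> ball p r. snd (T x) = \<gamma> (fst (T x))} < \<infinity>"
proof -
  let ?G = "{x \<in> ball p r. snd (T x) = \<gamma> (fst (T x))}"
  define B where "B = (\<lambda>x. fst (T x)) ` ?G"
  define g where "g = (\<lambda>z. inv T (z, \<gamma> z))"
  have "bij T" using T by (rule orthogonal_transformation_bij)
  have isoT: "dist (inv T u) (inv T v) = dist u v" for u v
    using orthogonal_transformation_inv[OF T] unfolding orthogonal_transformation_isometry by blast
  \<comment> \<open>T preserves norms, so the norm bound on the ball also bounds the coordinates of
    the projection; the summand 1 makes a positive.\<close>
  define a where "a = norm p + \<bar>r\<bar> + 1"
  have a: "a > 0" unfolding a_def using norm_ge_zero[of p] by linarith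
  have Ba: "\<bar>z $ i\<bar> \<le> a" if "z \<in> B" for z i
  proof -
    obtain x where x: "x \<in> ball p r" "z = fst (T x)" using \<open>z \<in> B\<close> unfolding B_def by blast
    have "norm x \<le> norm p + norm (p - x)"
      by (metis add.commute diff_add_cancel norm_minus_commute norm_triangle_ineq)
    then have "norm x \<le> a" using x by (auto simp: a_def dist_norm)
    moreover have "norm (T x) = norm x" by (rule orthogonal_transformation_norm[OF T])
    moreover have "norm z \<le> norm (T x)" unfolding x(2) by (metis norm_fst_le prod.collapse)
    moreover have "\<bar>z $ i\<bar> \<le> norm z" by (rule component_le_norm_cart)
    ultimately show ?thesis by linarith
  qed
  obtain C where C: "C \<ge> 0"
    "\<And>x y. x \<in> cbox (\<chi> i. - a) (\<chi> i. a) \<Longrightarrow> y \<in> cbox (\<chi> i. - a) (\<chi> i. a)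
      \<Longrightarrow> \<bar>\<gamma> x - \<gamma> y\<bar> \<le> C * norm (x - y)"
    using C2_function_lipschitz_on_cbox[OF \<gamma>] by blast
  have Bc: "z \<in> cbox (\<chi> i. - a) (\<chi> i. a)" if "z \<in> B" for z
    using Ba[OF that] by (auto simp: mem_box_cart abs_le_iff minus_le_iff)
  have "dist (g z) (g w) \<le> (1 + C) * dist z w" if "z \<in> B" "w \<in> B" for z w
  proof -
    have "dist (g z) (g w) = norm (z - w, \<gamma> z - \<gamma> w)"
      unfolding g_def isoT by (simp add: dist_norm)
    also have "\<dots> \<le> norm (z - w) + norm (\<gamma> z - \<gamma> w)" by (rule norm_Pair_le)
    also have "\<dots> \<le> (1 + C) * dist z w"
      using C(2)[OF Bc[OF that(1)] Bc[OF that(2)]] by (simp add: dist_norm algebra_simps)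
    finally show ?thesis .
  qed
  then have "hausdorff_outer CARD('n) (g ` B) < \<infinity>"
    by (rule hausdorff_outer_lipschitz_cube[where a = a]) (use C(1) a Ba in auto)
  moreover have "g ` B = ?G"
  proof -
    have "g (fst (T x)) = x" if "x \<in> ?G" for x
    proof -
      have "(fst (T x), \<gamma> (fst (T x))) = T x" using that by (simp add: prod_eq_iff)
      then show ?thesis using \<open>bij T\<close> by (simp add: g_def bij_is_inj)
    qed
    then have "(\<lambda>x. g (fst (T x))) ` ?G = (\<lambda>x. x) ` ?G" by (rule image_cong[OF refl])
    then show ?thesis unfolding B_def image_image by simp
  qed
  ultimately show ?thesis by simp
qed

lemma emeasure_frontier_C2_finite:
  fixes U :: "'n::finite point set"
  assumes "open U" "bounded U" "C2_boundary U"
  shows "emeasure (hausdorff_measure CARD('n)) (frontier U) < \<infinity>"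
proof -
  let ?M = "hausdorff_measure CARD('n) :: 'n point measure"
  have local: "\<exists>r>0. emeasure ?M (frontier U \<inter> ball p r) < \<infinity>" if "p \<in> frontier U" for p
  proof -
    obtain r and T :: "'n point \<Rightarrow> 'n point" and \<gamma> where r: "r > 0" "orthogonal_transformation T" "C2_function \<gamma>"
      "U \<inter> ball p r = {x \<in> ball p r. snd (T x) > \<gamma> (fst (T x))}"
      using assms(3) \<open>p \<in> frontier U\<close> unfolding C2_boundary_def by blast
    let ?G = "{x \<in> ball p r. snd (T x) = \<gamma> (fst (T x))}"
    have contT: "continuous_on UNIV T"
      using r(2) by (simp add: linear_continuous_on linear_linear orthogonal_transformation_linear)
    have cont\<gamma>: "continuous_on UNIV \<gamma>"
      using r(3) unfolding C2_function_def
      by (meson continuous_at_imp_continuous_on has_derivative_continuous)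
    have "continuous_on UNIV (\<lambda>x. \<gamma> (fst (T x)))"
      by (rule continuous_on_compose2[OF cont\<gamma>]) (auto intro!: continuous_intros contT)
    then have closed: "closed {x. snd (T x) = \<gamma> (fst (T x))}"
      by (intro closed_Collect_eq continuous_intros contT) auto
    have "ball p r \<inter> {x. snd (T x) = \<gamma> (fst (T x))} \<in> sets borel"
      by (intro sets.Int borel_open borel_closed open_ball closed)
    then have G: "?G \<in> sets borel" by (simp only: Int_def mem_Collect_eq)
    have "emeasure ?M (frontier U \<inter> ball p r) \<le> emeasure ?M ?G"
      using frontier_graph_subset[OF assms(1) contT cont\<gamma> r(4)] G by (intro emeasure_mono) auto
    also have "\<dots> \<le> hausdorff_outer CARD('n) ?G"
      using G by (simp add: emeasure_hausdorff_measure)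
    also have "\<dots> < \<infinity>"
      by (rule hausdorff_outer_C2_graph_finite[OF r(2,3)])
    finally show ?thesis using r(1) by blast
  qed
  then obtain r where r: "\<And>p. p \<in> frontier U \<Longrightarrow> r p > 0 \<and> emeasure ?M (frontier U \<inter> ball p (r p)) < \<infinity>"
    by metis
  have "compact (frontier U)" using assms(2) by (rule compact_frontier_bounded)
  then obtain P where P: "finite P" "P \<subseteq> frontier U" "frontier U \<subseteq> (\<Union>p\<in>P. ball p (r p))"
    by (rule compactE_image[of "frontier U" "frontier U" "\<lambda>p. ball p (r p)"]) (use r in auto)
  have "emeasure ?M (frontier U) \<le> emeasure ?M (\<Union>p\<in>P. frontier U \<inter> ball p (r p))"
    using P by (intro emeasure_mono sets.finite_UN) auto
  also have "\<dots> \<le> (\<Sum>p\<in>P. emeasure ?M (frontier U \<inter> ball p (r p)))"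
    using P by (intro emeasure_subadditive_finite) auto
  also have "\<dots> < \<infinity>"
    using P r by (auto simp: less_top[symmetric] ennreal_sum_less_top)
  finally show ?thesis .
qed

section \<open>Quadratic forms and square integrable functions\<close>

text \<open>Used for the Cauchy-Schwarz inequality and, with A = \<epsilon>^2, for the first
  variation at an approximate minimiser.\<close>

lemma nonneg_quadratic_imp_discriminant:
  fixes A b C :: real
  assumes "A \<ge> 0" "C \<ge> 0" and nonneg: "\<And>t. 0 \<le> A + 2 * t * b + t\<^sup>2 * C"
  shows "\<bar>b\<bar> \<le> sqrt A * sqrt C"
proof (cases "C = 0")
  case True
  have "b = 0"
  proof (rule ccontr)
    assume "b \<noteq> 0"
    \<comment> \<open>At this t the expression equals A - (A + 1) = -1.\<close>
    then show False using nonneg[of "- (A + 1) / (2 * b)"] True by (simp add: field_simps)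
  qed
  then show ?thesis using assms by simp
next
  case False
  then have "C > 0" using assms by simp
  then have "0 \<le> A * C - b\<^sup>2"
    using nonneg[of "- b / C"] by (simp add: field_simps power2_eq_square)
  then have "b\<^sup>2 \<le> A * C" by simp
  then have "sqrt (b\<^sup>2) \<le> sqrt (A * C)" by (rule real_sqrt_le_mono)
  then show ?thesis by (simp add: real_sqrt_mult)
qed

text \<open>A near minimiser of \<open>B(u, u) - 2 f(u)\<close> represents \<open>f\<close> approximately; unlike the Riesz
  representation theorem this needs no completeness.\<close>

lemma approximate_riesz:
  fixes V :: "('a \<Rightarrow> complex) set" and B :: "('a \<Rightarrow> complex) \<Rightarrow> ('a \<Rightarrow> complex) \<Rightarrow> real"
    and f :: "('a \<Rightarrow> complex) \<Rightarrow> real"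
  assumes closed: "\<And>u v t. u \<in> V \<Longrightarrow> v \<in> V \<Longrightarrow> (\<lambda>x. u x + of_real t * v x) \<in> V"
    and B: "\<And>u v t. u \<in> V \<Longrightarrow> v \<in> V \<Longrightarrow>
      B (\<lambda>x. u x + of_real t * v x) (\<lambda>x. u x + of_real t * v x)
        = B u u + 2 * t * B u v + t\<^sup>2 * B v v"
    and B_nonneg: "\<And>u. u \<in> V \<Longrightarrow> B u u \<ge> 0"
    and f: "\<And>u v t. u \<in> V \<Longrightarrow> v \<in> V \<Longrightarrow> f (\<lambda>x. u x + of_real t * v x) = f u + t * f v"
    and bound: "\<And>u. u \<in> V \<Longrightarrow> \<bar>f u\<bar> \<le> K * sqrt (B u u)"
    and "V \<noteq> {}" "\<epsilon> > 0"
  obtains w where "w \<in> V" "\<And>v. v \<in> V \<Longrightarrow> \<bar>f v - B w v\<bar> \<le> \<epsilon> * sqrt (B v v)"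
proof -
  define F where "F u = B u u - 2 * f u" for u
  \<comment> \<open>Completing the square in the norm of u bounds the energy from below, so its
    infimum is finite.\<close>
  have below: "- K\<^sup>2 \<le> F u" if "u \<in> V" for u
  proof -
    have "0 \<le> (sqrt (B u u) - K)\<^sup>2" by simp
    also have "\<dots> = B u u - 2 * (K * sqrt (B u u)) + K\<^sup>2"
      using B_nonneg[OF that] by (simp add: power2_diff)
    also have "\<dots> \<le> F u + K\<^sup>2"
      using bound[OF that] by (auto simp: F_def)
    finally show ?thesis by simp
  qed
  then have bdd: "bdd_below (F ` V)" by (rule bdd_belowI2)
  have "Inf (F ` V) < Inf (F ` V) + \<epsilon>\<^sup>2" using \<open>\<epsilon> > 0\<close> by simp
  then have "\<exists>x\<in>F ` V. x < Inf (F ` V) + \<epsilon>\<^sup>2"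
    using \<open>V \<noteq> {}\<close> bdd by (subst (asm) cInf_less_iff) simp_all
  then obtain w where w: "w \<in> V" "F w < Inf (F ` V) + \<epsilon>\<^sup>2" by blast
  have "\<bar>f v - B w v\<bar> \<le> \<epsilon> * sqrt (B v v)" if v: "v \<in> V" for v
  proof -
    \<comment> \<open>F(w) exceeds the infimum by less than \<epsilon>^2, so moving from w to w + t
      v can lower F by at most that amount. The discriminant of this quadratic in t is the claimed
      estimate.\<close>
    have "0 \<le> \<epsilon>\<^sup>2 + 2 * t * (B w v - f v) + t\<^sup>2 * B v v" for t
    proof -
      have "Inf (F ` V) \<le> F (\<lambda>x. w x + of_real t * v x)"
        by (rule cINF_lower[OF bdd closed[OF w(1) v]])
      also have "\<dots> = F w + 2 * t * (B w v - f v) + t\<^sup>2 * B v v"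
        using B[OF w(1) v] f[OF w(1) v] by (simp add: F_def algebra_simps)
      finally show ?thesis using w(2) by linarith
    qed
    then have "\<bar>B w v - f v\<bar> \<le> sqrt (\<epsilon>\<^sup>2) * sqrt (B v v)"
      by (intro nonneg_quadratic_imp_discriminant B_nonneg v) auto
    then show ?thesis using \<open>\<epsilon> > 0\<close> by (simp add: abs_minus_commute)
  qed
  then show thesis using w(1) that by blast
qed

section \<open>Square integrable complex functions on a general measure space\<close>

lemma cmod_sq_add_le: "(cmod (a + b))\<^sup>2 \<le> 2 * (cmod a)\<^sup>2 + 2 * (cmod b)\<^sup>2"
proof -
  have "(cmod (a + b))\<^sup>2 \<le> (cmod a + cmod b)\<^sup>2"
    by (intro power_mono norm_triangle_ineq) auto
  also have "\<dots> \<le> 2 * (cmod a)\<^sup>2 + 2 * (cmod b)\<^sup>2"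
    using sum_squares_bound[of "cmod a" "cmod b"] by (simp add: power2_sum)
  finally show ?thesis .
qed

text \<open>A crude form of Minkowski's inequality with factor 2. Being an inequality in
  \<open>ennreal\<close>, it can establish finiteness of the left-hand side.\<close>

lemma nn_integral_cmod_sq_add_le:
  assumes [measurable]: "f \<in> borel_measurable N" "g \<in> borel_measurable N"
  shows "(\<integral>\<^sup>+x. ennreal ((cmod (f x + g x))\<^sup>2) \<partial>N)
    \<le> 2 * (\<integral>\<^sup>+x. ennreal ((cmod (f x))\<^sup>2) \<partial>N) + 2 * (\<integral>\<^sup>+x. ennreal ((cmod (g x))\<^sup>2) \<partial>N)"
proof -
  have "(\<integral>\<^sup>+x. ennreal ((cmod (f x + g x))\<^sup>2) \<partial>N)
    \<le> (\<integral>\<^sup>+x. 2 * ennreal ((cmod (f x))\<^sup>2) + 2 * ennreal ((cmod (g x))\<^sup>2) \<partial>N)"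
  proof (rule nn_integral_mono)
    fix x
    have "ennreal ((cmod (f x + g x))\<^sup>2) \<le> ennreal (2 * (cmod (f x))\<^sup>2 + 2 * (cmod (g x))\<^sup>2)"
      by (intro ennreal_leI cmod_sq_add_le)
    then show "ennreal ((cmod (f x + g x))\<^sup>2) \<le> 2 * ennreal ((cmod (f x))\<^sup>2) + 2 * ennreal ((cmod (g x))\<^sup>2)"
      by (simp add: ennreal_mult')
  qed
  then show ?thesis by (simp add: nn_integral_add nn_integral_cmult)
qed

lemma nn_integral_cmod_sq_cmult:
  assumes [measurable]: "f \<in> borel_measurable N"
  shows "(\<integral>\<^sup>+x. ennreal ((cmod (a * f x))\<^sup>2) \<partial>N)
    = ennreal ((cmod a)\<^sup>2) * (\<integral>\<^sup>+x. ennreal ((cmod (f x))\<^sup>2) \<partial>N)"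
  by (simp add: norm_mult power_mult_distrib ennreal_mult' nn_integral_cmult)

lemma mult_le_sum_squares: "x * y \<le> x\<^sup>2 + (y :: real)\<^sup>2"
proof -
  have "0 \<le> (x - y / 2)\<^sup>2 + 3 / 4 * y\<^sup>2" by simp
  then show ?thesis by (simp add: power2_diff power_divide)
qed

lemma abs_inner_le_sq: "\<bar>a \<bullet> b\<bar> \<le> (norm a)\<^sup>2 + (norm b)\<^sup>2"
proof -
  have "\<bar>a \<bullet> b\<bar> \<le> norm a * norm b" by (rule Cauchy_Schwarz_ineq2)
  also have "\<dots> \<le> (norm a)\<^sup>2 + (norm b)\<^sup>2" by (rule mult_le_sum_squares)
  finally show ?thesis .
qed

lemma integrable_sq_iff:
  fixes f :: "'a \<Rightarrow> complex"
  assumes [measurable]: "f \<in> borel_measurable N"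
  shows "integrable N (\<lambda>x. (cmod (f x))\<^sup>2) \<longleftrightarrow> (\<integral>\<^sup>+x. ennreal ((cmod (f x))\<^sup>2) \<partial>N) < \<infinity>"
  by (simp add: integrable_iff_bounded)

text \<open>The measure N is general because this is applied on the surface, on its square and on
  the square with the Slobodeckij weight. On complex numbers a \<bullet> b is the real part of a
  times the conjugate of b.\<close>

lemma integrable_inner_sq:
  fixes f g :: "'a \<Rightarrow> complex"
  assumes [measurable]: "f \<in> borel_measurable N" "g \<in> borel_measurable N"
    and "(\<integral>\<^sup>+x. ennreal ((cmod (f x))\<^sup>2) \<partial>N) < \<infinity>" "(\<integral>\<^sup>+x. ennreal ((cmod (g x))\<^sup>2) \<partial>N) < \<infinity>"
  shows "integrable N (\<lambda>x. f x \<bullet> g x)"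
proof (rule Bochner_Integration.integrable_bound)
  show "integrable N (\<lambda>x. (cmod (f x))\<^sup>2 + (cmod (g x))\<^sup>2)"
    using assms by (intro Bochner_Integration.integrable_add) (simp_all add: integrable_sq_iff)
qed (use abs_inner_le_sq in \<open>auto intro!: AE_I2 simp: order.trans[OF _ abs_ge_self]\<close>)

lemma integral_inner_Cauchy_Schwarz:
  fixes f g :: "'a \<Rightarrow> complex"
  assumes [measurable]: "f \<in> borel_measurable N" "g \<in> borel_measurable N"
    and fin: "(\<integral>\<^sup>+x. ennreal ((cmod (f x))\<^sup>2) \<partial>N) < \<infinity>" "(\<integral>\<^sup>+x. ennreal ((cmod (g x))\<^sup>2) \<partial>N) < \<infinity>"
  shows "\<bar>LINT x|N. f x \<bullet> g x\<bar> \<le> sqrt (LINT x|N. f x \<bullet> f x) * sqrt (LINT x|N. g x \<bullet> g x)"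
proof (rule nonneg_quadratic_imp_discriminant)
  fix t :: real
  have int: "integrable N (\<lambda>x. f x \<bullet> f x)" "integrable N (\<lambda>x. f x \<bullet> g x)" "integrable N (\<lambda>x. g x \<bullet> g x)"
    using assms by (auto intro!: integrable_inner_sq)
  have "0 \<le> (LINT x|N. (f x + t *\<^sub>R g x) \<bullet> (f x + t *\<^sub>R g x))"
    by (intro integral_nonneg_AE) auto
  also have "\<dots> = (LINT x|N. f x \<bullet> f x + 2 * t * (f x \<bullet> g x) + t\<^sup>2 * (g x \<bullet> g x))"
    by (intro Bochner_Integration.integral_cong refl)
      (simp add: inner_simps inner_commute[of "g _" "f _"] power2_eq_square algebra_simps)
  also have "\<dots> = (LINT x|N. f x \<bullet> f x) + 2 * t * (LINT x|N. f x \<bullet> g x) + t\<^sup>2 * (LINT x|N. g x \<bullet> g x)"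
    using int by simp
  finally show "0 \<le> (LINT x|N. f x \<bullet> f x) + 2 * t * (LINT x|N. f x \<bullet> g x) + t\<^sup>2 * (LINT x|N. g x \<bullet> g x)" .
qed (auto intro!: integral_nonneg_AE)

section \<open>Density of square integrable functions\<close>

text \<open>Finiteness makes constants square integrable and square integrable functions integrable,
  and makes the product measure sigma-finite, so that Tonelli and Fubini apply.\<close>

locale finite_surface =
  fixes \<Gamma> :: "'a::euclidean_space set"
  assumes emeasure_finite: "emeasure (surface_measure \<Gamma>) \<Gamma> < \<infinity>"
begin

abbreviation M where "M \<equiv> surface_measure \<Gamma>"

sublocale finite_measure M
  by standard (use emeasure_finite in auto)

sublocale pair: pair_sigma_finite M M ..

text \<open>On the diagonal the quotient is 0 by the convention for division by zero, in agreement
  with the integrand of \<open>H_half_sq\<close> there.\<close>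

definition slobodeckij_kernel :: "'a \<times> 'a \<Rightarrow> real" where
  "slobodeckij_kernel p = 1 / dist (fst p) (snd p) ^ DIM('a)"

definition delta :: "('a \<Rightarrow> complex) \<Rightarrow> 'a \<times> 'a \<Rightarrow> complex" where
  "delta u p = u (fst p) - u (snd p)"

text \<open>With respect to this measure the Slobodeckij seminorm of u is the L2 norm of
  \<open>delta u\<close>, so general L2 facts serve both parts of the Sobolev norm.\<close>

definition pair_weighted :: "('a \<times> 'a) measure" where
  "pair_weighted = density (M \<Otimes>\<^sub>M M) (\<lambda>p. ennreal (slobodeckij_kernel p))"

text \<open>The real part of the inner product of H^(1/2); a real form suits the minimisation, which
  varies along real multiples.\<close>

definition H_half_inner :: "('a \<Rightarrow> complex) \<Rightarrow> ('a \<Rightarrow> complex) \<Rightarrow> real" where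
  "H_half_inner u v = (LINT x|M. u x \<bullet> v x) + (LINT p|pair_weighted. delta u p \<bullet> delta v p)"

lemma kernel_nonneg [simp]: "0 \<le> slobodeckij_kernel p"
  by (simp add: slobodeckij_kernel_def)

lemma measurable_ident_surface [measurable]: "(\<lambda>x. x) \<in> M \<rightarrow>\<^sub>M borel"
proof -
  have "(\<lambda>x. x) \<in> restrict_space borel \<Gamma> \<rightarrow>\<^sub>M borel"
    by (rule measurable_restrict_space1) simp
  then show ?thesis by (simp cong: measurable_cong_sets add: sets_surface_measure)
qed

lemma kernel_measurable [measurable]: "slobodeckij_kernel \<in> borel_measurable (M \<Otimes>\<^sub>M M)"
proof -
  have [measurable]: "fst \<in> M \<Otimes>\<^sub>M M \<rightarrow>\<^sub>M borel" "snd \<in> M \<Otimes>\<^sub>M M \<rightarrow>\<^sub>M borel"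
    using measurable_compose[OF measurable_fst measurable_ident_surface]
      measurable_compose[OF measurable_snd measurable_ident_surface] by auto
  show ?thesis unfolding slobodeckij_kernel_def by measurable
qed

lemma sets_pair_weighted [measurable_cong]: "sets pair_weighted = sets (M \<Otimes>\<^sub>M M)"
  by (simp add: pair_weighted_def)

lemma delta_measurable [measurable]:
  assumes [measurable]: "u \<in> borel_measurable M"
  shows "delta u \<in> borel_measurable (M \<Otimes>\<^sub>M M)"
  unfolding delta_def by measurable

lemma H_half_sq_eq:
  assumes [measurable]: "u \<in> borel_measurable M"
  shows "H_half_sq \<Gamma> u = (\<integral>\<^sup>+x. ennreal ((cmod (u x))\<^sup>2) \<partial>M) + (\<integral>\<^sup>+p. ennreal ((cmod (delta u p))\<^sup>2) \<partial>pair_weighted)"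
proof -
  have "(\<integral>\<^sup>+p. ennreal ((cmod (delta u p))\<^sup>2) \<partial>pair_weighted)
    = (\<integral>\<^sup>+p. ennreal (slobodeckij_kernel p) * ennreal ((cmod (delta u p))\<^sup>2) \<partial>(M \<Otimes>\<^sub>M M))"
    unfolding pair_weighted_def by (rule nn_integral_density) measurable
  also have "\<dots> = (\<integral>\<^sup>+x. \<integral>\<^sup>+y. ennreal (slobodeckij_kernel (x, y)) * ennreal ((cmod (delta u (x, y)))\<^sup>2) \<partial>M \<partial>M)"
    by (rule nn_integral_fst[where f = "\<lambda>p. ennreal (slobodeckij_kernel p) * ennreal ((cmod (delta u p))\<^sup>2)", symmetric]) measurable
  also have "\<dots> = (\<integral>\<^sup>+x. \<integral>\<^sup>+y. ennreal ((cmod (u x - u y))\<^sup>2 / dist x y ^ DIM('a)) \<partial>M \<partial>M)"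
    by (intro nn_integral_cong) (simp add: slobodeckij_kernel_def delta_def flip: ennreal_mult')
  finally show ?thesis unfolding H_half_sq_def by simp
qed

lemma H_half_iff:
  "u \<in> H_half \<Gamma> \<longleftrightarrow> u \<in> borel_measurable M \<and>
    (\<integral>\<^sup>+x. ennreal ((cmod (u x))\<^sup>2) \<partial>M) < \<infinity> \<and> (\<integral>\<^sup>+p. ennreal ((cmod (delta u p))\<^sup>2) \<partial>pair_weighted) < \<infinity>"
  unfolding H_half_def using H_half_sq_eq by auto

lemma H_half_measurable [measurable_dest]: "u \<in> H_half \<Gamma> \<Longrightarrow> u \<in> borel_measurable M"
  by (simp add: H_half_iff)

lemma delta_add: "delta (\<lambda>x. u x + v x) = (\<lambda>p. delta u p + delta v p)"
  and delta_cmult: "delta (\<lambda>x. a * u x) = (\<lambda>p. a * delta u p)"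
  by (auto simp: delta_def algebra_simps)

lemma H_half_sq_add_le:
  assumes [measurable]: "u \<in> borel_measurable M" "v \<in> borel_measurable M"
  shows "H_half_sq \<Gamma> (\<lambda>x. u x + v x) \<le> 2 * H_half_sq \<Gamma> u + 2 * H_half_sq \<Gamma> v"
proof -
  have "H_half_sq \<Gamma> (\<lambda>x. u x + v x)
    = (\<integral>\<^sup>+x. ennreal ((cmod (u x + v x))\<^sup>2) \<partial>M) + (\<integral>\<^sup>+p. ennreal ((cmod (delta u p + delta v p))\<^sup>2) \<partial>pair_weighted)"
    by (simp add: H_half_sq_eq delta_add)
  also have "\<dots> \<le> (2 * (\<integral>\<^sup>+x. ennreal ((cmod (u x))\<^sup>2) \<partial>M) + 2 * (\<integral>\<^sup>+x. ennreal ((cmod (v x))\<^sup>2) \<partial>M))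
     + (2 * (\<integral>\<^sup>+p. ennreal ((cmod (delta u p))\<^sup>2) \<partial>pair_weighted) + 2 * (\<integral>\<^sup>+p. ennreal ((cmod (delta v p))\<^sup>2) \<partial>pair_weighted))"
    by (intro add_mono nn_integral_cmod_sq_add_le) measurable
  also have "\<dots> = 2 * H_half_sq \<Gamma> u + 2 * H_half_sq \<Gamma> v"
    by (simp add: H_half_sq_eq distrib_left add_ac)
  finally show ?thesis .
qed

lemma H_half_sq_cmult:
  assumes [measurable]: "u \<in> borel_measurable M"
  shows "H_half_sq \<Gamma> (\<lambda>x. a * u x) = ennreal ((cmod a)\<^sup>2) * H_half_sq \<Gamma> u"
  by (simp add: H_half_sq_eq delta_cmult nn_integral_cmod_sq_cmult distrib_left)

lemma H_half_add:
  assumes "u \<in> H_half \<Gamma>" "v \<in> H_half \<Gamma>"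
  shows "(\<lambda>x. u x + v x) \<in> H_half \<Gamma>"
proof -
  have [measurable]: "u \<in> borel_measurable M" "v \<in> borel_measurable M"
    using assms by (auto intro: H_half_measurable)
  have "2 * H_half_sq \<Gamma> u + 2 * H_half_sq \<Gamma> v < \<infinity>"
    using assms by (simp add: H_half_def ennreal_mult_less_top)
  then have "H_half_sq \<Gamma> (\<lambda>x. u x + v x) < \<infinity>"
    by (rule order.strict_trans1[rotated]) (rule H_half_sq_add_le; measurable)
  then show ?thesis by (simp add: H_half_def)
qed

lemma H_half_cmult:
  assumes "u \<in> H_half \<Gamma>"
  shows "(\<lambda>x. a * u x) \<in> H_half \<Gamma>"
proof -
  have [measurable]: "u \<in> borel_measurable M"
    using assms by (rule H_half_measurable)
  show ?thesis
    using assms by (simp add: H_half_def H_half_sq_cmult ennreal_mult_less_top)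
qed

lemma H_half_zero: "(\<lambda>_. 0) \<in> H_half \<Gamma>"
  by (auto simp: H_half_iff delta_def)

lemma H_half_diff: "u \<in> H_half \<Gamma> \<Longrightarrow> v \<in> H_half \<Gamma> \<Longrightarrow> (\<lambda>x. u x - v x) \<in> H_half \<Gamma>"
  using H_half_add[OF _ H_half_cmult[of v "-1"], of u] by simp

lemma H_half_norm_nonneg [simp]: "0 \<le> H_half_norm \<Gamma> u"
  by (simp add: H_half_norm_def)

text \<open>A quasi-triangle inequality inherited from the bound on squares; its uses tolerate a
  constant factor.\<close>

lemma H_half_norm_add_le:
  assumes "u \<in> H_half \<Gamma>" "v \<in> H_half \<Gamma>"
  shows "H_half_norm \<Gamma> (\<lambda>x. u x + v x) \<le> 2 * (H_half_norm \<Gamma> u + H_half_norm \<Gamma> v)"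
proof -
  let ?a = "enn2real (H_half_sq \<Gamma> u)" and ?b = "enn2real (H_half_sq \<Gamma> v)"
  have "H_half_sq \<Gamma> (\<lambda>x. u x + v x) \<le> 2 * H_half_sq \<Gamma> u + 2 * H_half_sq \<Gamma> v"
    using assms by (intro H_half_sq_add_le) (auto simp: H_half_def)
  also have "\<dots> = ennreal (2 * ?a + 2 * ?b)"
    using assms by (simp add: H_half_def ennreal_mult')
  finally have "enn2real (H_half_sq \<Gamma> (\<lambda>x. u x + v x)) \<le> 2 * ?a + 2 * ?b"
    by (intro enn2real_leI) auto
  also have "\<dots> \<le> (2 * (sqrt ?a + sqrt ?b))\<^sup>2"
    by (simp add: power2_sum power_mult_distrib)
  finally show ?thesis
    unfolding H_half_norm_def by (intro real_le_lsqrt) auto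
qed

lemma H_half_norm_cmult:
  "u \<in> H_half \<Gamma> \<Longrightarrow> H_half_norm \<Gamma> (\<lambda>x. a * u x) = cmod a * H_half_norm \<Gamma> u"
  by (simp add: H_half_norm_def H_half_sq_cmult H_half_measurable enn2real_mult real_sqrt_mult)

lemma H_half_norm_diff_le:
  assumes "u \<in> H_half \<Gamma>" "v \<in> H_half \<Gamma>"
  shows "H_half_norm \<Gamma> (\<lambda>x. u x - v x) \<le> 2 * (H_half_norm \<Gamma> u + H_half_norm \<Gamma> v)"
  using H_half_norm_add_le[OF assms(1) H_half_cmult[OF assms(2), of "-1"]]
    H_half_norm_cmult[OF assms(2), of "-1"] by simp

text \<open>Converts the vanishing-norm conditions in \<open>bounded_op\<close> and
  \<open>inverse_ops\<close> into almost-everywhere equalities.\<close>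

lemma H_half_norm_eq_0_iff:
  assumes u: "u \<in> H_half \<Gamma>"
  shows "H_half_norm \<Gamma> u = 0 \<longleftrightarrow> (AE x in M. u x = 0)"
proof
  have [measurable]: "u \<in> borel_measurable M" using u by (rule H_half_measurable)
  {
    assume "H_half_norm \<Gamma> u = 0"
    then have "H_half_sq \<Gamma> u = 0"
      using u by (auto simp: H_half_norm_def H_half_def enn2real_eq_0_iff)
    then have "(\<integral>\<^sup>+x. ennreal ((cmod (u x))\<^sup>2) \<partial>M) = 0" by (simp add: H_half_sq_def)
    then show "AE x in M. u x = 0" by (simp add: nn_integral_0_iff_AE)
  }
  assume AE: "AE x in M. u x = 0"
  have "(\<integral>\<^sup>+x. ennreal ((cmod (u x))\<^sup>2) \<partial>M) = (\<integral>\<^sup>+x. 0 \<partial>M)"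
    using AE by (intro nn_integral_cong_AE) auto
  moreover have "(\<integral>\<^sup>+x. \<integral>\<^sup>+y. ennreal ((cmod (u x - u y))\<^sup>2 / dist x y ^ DIM('a)) \<partial>M \<partial>M) = (\<integral>\<^sup>+x. 0 \<partial>M)"
  proof (intro nn_integral_cong_AE, use AE in eventually_elim)
    fix x assume x: "u x = 0"
    have "(\<integral>\<^sup>+y. ennreal ((cmod (u x - u y))\<^sup>2 / dist x y ^ DIM('a)) \<partial>M) = (\<integral>\<^sup>+y. 0 \<partial>M)"
      by (intro nn_integral_cong_AE, use AE in eventually_elim) (simp add: x)
    then show "(\<integral>\<^sup>+y. ennreal ((cmod (u x - u y))\<^sup>2 / dist x y ^ DIM('a)) \<partial>M) = 0" by simp
  qed
  ultimately show "H_half_norm \<Gamma> u = 0" by (simp add: H_half_norm_def H_half_sq_def)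
qed

lemma H_half_inner_self:
  assumes u: "u \<in> H_half \<Gamma>"
  shows "sqrt (H_half_inner u u) = H_half_norm \<Gamma> u"
proof -
  have [measurable]: "u \<in> borel_measurable M" using u by (rule H_half_measurable)
  have fin: "(\<integral>\<^sup>+x. ennreal ((cmod (u x))\<^sup>2) \<partial>M) < \<infinity>" "(\<integral>\<^sup>+p. ennreal ((cmod (delta u p))\<^sup>2) \<partial>pair_weighted) < \<infinity>"
    using u by (auto simp: H_half_iff)
  have "enn2real (H_half_sq \<Gamma> u)
    = enn2real (\<integral>\<^sup>+x. ennreal ((cmod (u x))\<^sup>2) \<partial>M) + enn2real (\<integral>\<^sup>+p. ennreal ((cmod (delta u p))\<^sup>2) \<partial>pair_weighted)"
    using fin by (simp add: H_half_sq_eq enn2real_plus)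
  also have "\<dots> = H_half_inner u u"
    by (simp add: H_half_inner_def dot_square_norm integral_eq_nn_integral)
  finally show ?thesis by (simp add: H_half_norm_def)
qed

lemma H_half_inner_integrable:
  assumes "u \<in> H_half \<Gamma>" "v \<in> H_half \<Gamma>"
  shows "integrable M (\<lambda>x. u x \<bullet> v x)" "integrable pair_weighted (\<lambda>p. delta u p \<bullet> delta v p)"
proof -
  have [measurable]: "u \<in> borel_measurable M" "v \<in> borel_measurable M" 
    using assms by (auto intro: H_half_measurable)
  show "integrable M (\<lambda>x. u x \<bullet> v x)" "integrable pair_weighted (\<lambda>p. delta u p \<bullet> delta v p)"
    using assms by (auto simp: H_half_iff intro!: integrable_inner_sq)
qed

lemma H_half_inner_add_cmult:
  assumes u: "u \<in> H_half \<Gamma>" and v: "v \<in> H_half \<Gamma>"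
  shows "H_half_inner (\<lambda>x. u x + of_real t * v x) (\<lambda>x. u x + of_real t * v x)
    = H_half_inner u u + 2 * t * H_half_inner u v + t\<^sup>2 * H_half_inner v v"
proof -
  have expand: "(a + of_real t * b) \<bullet> (a + of_real t * b) = a \<bullet> a + 2 * t * (a \<bullet> b) + t\<^sup>2 * (b \<bullet> b)"
    for a b :: complex
    by (simp add: inner_complex_def algebra_simps power2_eq_square)
  show ?thesis
    using H_half_inner_integrable[OF u u] H_half_inner_integrable[OF u v] H_half_inner_integrable[OF v v]
    unfolding H_half_inner_def delta_add delta_cmult expand by (simp add: distrib_left)
qed

lemma L2_measurable [measurable_dest]: "g \<in> L2_space \<Gamma> \<Longrightarrow> g \<in> borel_measurable M"
  by (simp add: L2_space_def)

lemma H_half_subset_L2: "u \<in> H_half \<Gamma> \<Longrightarrow> u \<in> L2_space \<Gamma>"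
  by (auto simp: H_half_iff L2_space_def)

lemma L2_integrable_mult_cnj:
  assumes "f \<in> L2_space \<Gamma>" "g \<in> L2_space \<Gamma>"
  shows "integrable M (\<lambda>x. f x * cnj (g x))"
proof (rule Bochner_Integration.integrable_bound)
  have [measurable]: "f \<in> borel_measurable M" "g \<in> borel_measurable M" 
    using assms by (auto intro: L2_measurable)
  show "integrable M (\<lambda>x. (cmod (f x))\<^sup>2 + (cmod (g x))\<^sup>2)"
    using assms by (intro Bochner_Integration.integrable_add) (auto simp: integrable_sq_iff L2_space_def)
  have [measurable]: "cnj \<in> borel_measurable borel"
    by (intro borel_measurable_continuous_onI continuous_intros)
  show "(\<lambda>x. f x * cnj (g x)) \<in> borel_measurable M" by measurable
  have "norm (f x * cnj (g x)) \<le> norm ((cmod (f x))\<^sup>2 + (cmod (g x))\<^sup>2)" for x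
    using mult_le_sum_squares[of "cmod (f x)" "cmod (g x)"] by (simp add: norm_mult)
  then show "AE x in M. norm (f x * cnj (g x)) \<le> norm ((cmod (f x))\<^sup>2 + (cmod (g x))\<^sup>2)" by simp
qed

lemma L2_integrable: "f \<in> L2_space \<Gamma> \<Longrightarrow> integrable M f"
  using L2_integrable_mult_cnj[of f "\<lambda>_. 1"] by (simp add: L2_space_def less_top emeasure_eq_measure)

lemma Re_of_density:
  assumes "f \<in> L2_space \<Gamma>" "g \<in> L2_space \<Gamma>"
  shows "Re (of_density \<Gamma> f g) = (LINT x|M. f x \<bullet> g x)"
  unfolding of_density_def integral_Re[OF L2_integrable_mult_cnj[OF assms], symmetric]
  by (simp add: inner_complex_def)

lemma L2_add:
  assumes "f \<in> L2_space \<Gamma>" "g \<in> L2_space \<Gamma>"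
  shows "(\<lambda>x. f x + g x) \<in> L2_space \<Gamma>"
proof -
  have [measurable]: "f \<in> borel_measurable M" "g \<in> borel_measurable M"
    using assms by (auto intro: L2_measurable)
  have "2 * (\<integral>\<^sup>+x. ennreal ((cmod (f x))\<^sup>2) \<partial>M) + 2 * (\<integral>\<^sup>+x. ennreal ((cmod (g x))\<^sup>2) \<partial>M) < \<infinity>"
    using assms by (simp add: L2_space_def ennreal_mult_less_top)
  then have "(\<integral>\<^sup>+x. ennreal ((cmod (f x + g x))\<^sup>2) \<partial>M) < \<infinity>"
    by (rule order.strict_trans1[rotated]) (rule nn_integral_cmod_sq_add_le; measurable)
  then show ?thesis by (simp add: L2_space_def)
qed

lemma L2_cmult:
  assumes "g \<in> L2_space \<Gamma>"
  shows "(\<lambda>x. a * g x) \<in> L2_space \<Gamma>"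
  using assms L2_measurable[OF assms, measurable] by (simp add: L2_space_def nn_integral_cmod_sq_cmult ennreal_mult_less_top)

lemma L2_fst_snd:
  assumes v: "v \<in> L2_space \<Gamma>"
  shows "(\<integral>\<^sup>+p. ennreal ((cmod (v (fst p)))\<^sup>2) \<partial>(M \<Otimes>\<^sub>M M)) < \<infinity>"
    and "(\<integral>\<^sup>+p. ennreal ((cmod (v (snd p)))\<^sup>2) \<partial>(M \<Otimes>\<^sub>M M)) < \<infinity>"
proof -
  have [measurable]: "v \<in> borel_measurable M" using v by (rule L2_measurable)
  show "(\<integral>\<^sup>+p. ennreal ((cmod (v (fst p)))\<^sup>2) \<partial>(M \<Otimes>\<^sub>M M)) < \<infinity>"
    using v by (subst nn_integral_fst[symmetric])
      (auto simp: L2_space_def nn_integral_multc ennreal_mult_less_top emeasure_eq_measure)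
  show "(\<integral>\<^sup>+p. ennreal ((cmod (v (snd p)))\<^sup>2) \<partial>(M \<Otimes>\<^sub>M M)) < \<infinity>"
    using v by (subst nn_integral_fst[symmetric])
      (auto simp: L2_space_def nn_integral_multc ennreal_mult_less_top emeasure_eq_measure)
qed

section \<open>Cutting off the singular kernel near the diagonal\<close>

text \<open>The kernel is set to 0, not capped at n, where it exceeds n. The truncated form is thus
  the weighted form restricted to a set, and the error is the integral over the complement.\<close>

definition truncated_kernel :: "nat \<Rightarrow> 'a \<times> 'a \<Rightarrow> real" where
  "truncated_kernel n p = (if slobodeckij_kernel p \<le> real n then slobodeckij_kernel p else 0)"

text \<open>A regional fractional Laplacian of order 1 on the surface with truncated kernel, the
  operator of the truncated quadratic form. The factor 2 comes from symmetrising that form.\<close>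

definition truncated_laplacian :: "nat \<Rightarrow> ('a \<Rightarrow> complex) \<Rightarrow> 'a \<Rightarrow> complex" where
  "truncated_laplacian n w x = 2 *\<^sub>R (LINT y|M. truncated_kernel n (x, y) *\<^sub>R (w x - w y))"

lemma truncated_kernel_measurable [measurable]:
  "truncated_kernel n \<in> borel_measurable (M \<Otimes>\<^sub>M M)"
  unfolding truncated_kernel_def by measurable

lemma truncated_kernel_bounds: "0 \<le> truncated_kernel n p" "truncated_kernel n p \<le> real n"
  by (auto simp: truncated_kernel_def)

lemma truncated_kernel_swap: "truncated_kernel n (y, x) = truncated_kernel n (x, y)"
  by (simp add: truncated_kernel_def slobodeckij_kernel_def dist_commute)

lemma truncated_kernel_integrable:
  assumes w: "w \<in> L2_space \<Gamma>" and [measurable]: "x \<in> space M"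
  shows "integrable M (\<lambda>y. truncated_kernel n (x, y) *\<^sub>R (w x - w y))"
    and "norm (truncated_kernel n (x, y) *\<^sub>R (w x - w y)) \<le> real n * (cmod (w x) + cmod (w y))"
proof -
  note [measurable] = L2_measurable[OF w]
  show bound: "norm (truncated_kernel n (x, y) *\<^sub>R (w x - w y)) \<le> real n * (cmod (w x) + cmod (w y))" for y
    unfolding norm_scaleR
    using truncated_kernel_bounds[of n "(x, y)"] norm_triangle_ineq4[of "w x" "w y"]
    by (auto intro!: mult_mono)
  show "integrable M (\<lambda>y. truncated_kernel n (x, y) *\<^sub>R (w x - w y))"
  proof (rule Bochner_Integration.integrable_bound)
    show "integrable M (\<lambda>y. real n * (cmod (w x) + cmod (w y)))"
      using L2_integrable[OF w] by simp
    show "AE y in M. norm (truncated_kernel n (x, y) *\<^sub>R (w x - w y))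
      \<le> norm (real n * (cmod (w x) + cmod (w y)))"
      using bound by (intro AE_I2) (simp add: order.trans[OF _ abs_ge_self])
  qed measurable
qed

text \<open>The kernel is at most n and the measure is finite, so the value at x is bounded by a
  multiple of the modulus of w at x plus a constant.\<close>

lemma truncated_laplacian_L2:
  assumes w: "w \<in> L2_space \<Gamma>"
  shows "truncated_laplacian n w \<in> L2_space \<Gamma>"
proof -
  note [measurable] = L2_measurable[OF w]
  have meas [measurable]: "truncated_laplacian n w \<in> borel_measurable M"
    unfolding truncated_laplacian_def by measurable
  define C where "C = 2 * real n * measure M \<Gamma>"
  define I where "I = 2 * real n * (LINT y|M. cmod (w y))"
  have bound: "cmod (truncated_laplacian n w x) \<le> C * cmod (w x) + I" if x: "x \<in> space M" for x
  proof -
    have "cmod (LINT y|M. truncated_kernel n (x, y) *\<^sub>R (w x - w y))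
      \<le> (LINT y|M. real n * (cmod (w x) + cmod (w y)))"
    proof (rule Bochner_Integration.integral_norm_bound_integral[OF truncated_kernel_integrable(1)[OF w x] _
          truncated_kernel_integrable(2)[OF w x]])
      show "integrable M (\<lambda>y. real n * (cmod (w x) + cmod (w y)))"
        using L2_integrable[OF w] by simp
    qed
    then show ?thesis
      using L2_integrable[OF w] by (simp add: truncated_laplacian_def C_def I_def algebra_simps)
  qed
  have "integrable M (\<lambda>x. (cmod (truncated_laplacian n w x))\<^sup>2)"
  proof (rule Bochner_Integration.integrable_bound)
    have "integrable M (\<lambda>x. (cmod (w x))\<^sup>2)"
      using w by (simp add: L2_space_def integrable_sq_iff)
    then show "integrable M (\<lambda>x. 2 * C\<^sup>2 * (cmod (w x))\<^sup>2 + 2 * I\<^sup>2)" by simp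
    have "(cmod (truncated_laplacian n w x))\<^sup>2 \<le> 2 * C\<^sup>2 * (cmod (w x))\<^sup>2 + 2 * I\<^sup>2"
      if x: "x \<in> space M" for x
    proof -
      have "(cmod (truncated_laplacian n w x))\<^sup>2 \<le> (C * cmod (w x) + I)\<^sup>2"
        by (intro power_mono bound[OF x]) auto
      also have "\<dots> \<le> 2 * C\<^sup>2 * (cmod (w x))\<^sup>2 + 2 * I\<^sup>2"
        using sum_squares_bound[of "C * cmod (w x)" I] by (simp add: power2_sum power_mult_distrib)
      finally show ?thesis .
    qed
    then show "AE x in M. norm ((cmod (truncated_laplacian n w x))\<^sup>2)
      \<le> norm (2 * C\<^sup>2 * (cmod (w x))\<^sup>2 + 2 * I\<^sup>2)"
      by (intro AE_I2) (simp del: space_surface_measure)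
  qed measurable
  then show ?thesis by (simp add: L2_space_def integrable_sq_iff)
qed

text \<open>Integration by parts for the nonlocal operator: f is antisymmetric under exchange of its
  arguments, so the terms with v at the first and at the second point contribute equally. The
  bounded kernel makes these two terms separately integrable, which allows the splitting.\<close>

lemma integral_truncated_form:
  assumes w: "w \<in> L2_space \<Gamma>" and v: "v \<in> L2_space \<Gamma>"
  shows "(LINT p|(M \<Otimes>\<^sub>M M). truncated_kernel n p * (delta w p \<bullet> delta v p))
    = (LINT x|M. truncated_laplacian n w x \<bullet> v x)"
proof -
  note [measurable] = L2_measurable[OF w] L2_measurable[OF v]
  define f where "f p = truncated_kernel n p *\<^sub>R delta w p" for p
  have [measurable]: "f \<in> borel_measurable (M \<Otimes>\<^sub>M M)" unfolding f_def by measurable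
  have swap: "f (snd p, fst p) = - f p" for p
    using truncated_kernel_swap[of n "snd p" "fst p"] by (simp add: f_def delta_def algebra_simps)
  have f2: "(\<integral>\<^sup>+p. ennreal ((cmod (f p))\<^sup>2) \<partial>(M \<Otimes>\<^sub>M M)) < \<infinity>"
  proof -
    have "(\<integral>\<^sup>+p. ennreal ((cmod (f p))\<^sup>2) \<partial>(M \<Otimes>\<^sub>M M))
      \<le> (\<integral>\<^sup>+p. ennreal ((real n)\<^sup>2) * ennreal ((cmod (w (fst p) + - 1 * w (snd p)))\<^sup>2) \<partial>(M \<Otimes>\<^sub>M M))"
    proof (rule nn_integral_mono)
      fix p
      have "(cmod (f p))\<^sup>2 \<le> (real n * cmod (delta w p))\<^sup>2"
        unfolding f_def norm_scaleR
        by (intro power_mono mult_right_mono) (use truncated_kernel_bounds[of n p] in auto)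
      then show "ennreal ((cmod (f p))\<^sup>2)
        \<le> ennreal ((real n)\<^sup>2) * ennreal ((cmod (w (fst p) + - 1 * w (snd p)))\<^sup>2)"
        by (simp add: delta_def power_mult_distrib flip: ennreal_mult)
    qed
    also have "\<dots> = ennreal ((real n)\<^sup>2) * (\<integral>\<^sup>+p. ennreal ((cmod (w (fst p) + - 1 * w (snd p)))\<^sup>2) \<partial>(M \<Otimes>\<^sub>M M))"
      by (rule nn_integral_cmult) measurable
    also have "\<dots> \<le> ennreal ((real n)\<^sup>2) * (2 * (\<integral>\<^sup>+p. ennreal ((cmod (w (fst p)))\<^sup>2) \<partial>(M \<Otimes>\<^sub>M M))
        + 2 * (\<integral>\<^sup>+p. ennreal ((cmod (- 1 * w (snd p)))\<^sup>2) \<partial>(M \<Otimes>\<^sub>M M)))"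
      by (intro mult_left_mono nn_integral_cmod_sq_add_le) auto
    also have "\<dots> < \<infinity>"
      using L2_fst_snd[OF w] by (simp add: ennreal_mult_less_top)
    finally show ?thesis .
  qed
  have int1: "integrable (M \<Otimes>\<^sub>M M) (\<lambda>p. f p \<bullet> v (fst p))"
    and int2: "integrable (M \<Otimes>\<^sub>M M) (\<lambda>p. f p \<bullet> v (snd p))"
    using f2 L2_fst_snd[OF v] by (auto intro!: integrable_inner_sq)
  have "(LINT p|(M \<Otimes>\<^sub>M M). truncated_kernel n p * (delta w p \<bullet> delta v p))
    = (LINT p|(M \<Otimes>\<^sub>M M). f p \<bullet> v (fst p) - f p \<bullet> v (snd p))"
    by (intro Bochner_Integration.integral_cong refl) (simp add: f_def delta_def[of v] inner_diff_right right_diff_distrib)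
  also have "\<dots> = (LINT p|(M \<Otimes>\<^sub>M M). f p \<bullet> v (fst p)) - (LINT p|(M \<Otimes>\<^sub>M M). f p \<bullet> v (snd p))"
    using int1 int2 by simp
  also have "(LINT p|(M \<Otimes>\<^sub>M M). f p \<bullet> v (snd p)) = (LINT (x, y)|(M \<Otimes>\<^sub>M M). f (y, x) \<bullet> v (snd (y, x)))"
    by (rule pair.integral_product_swap[where f = "\<lambda>p. f p \<bullet> v (snd p)", symmetric]) measurable
  also have "\<dots> = (LINT p|(M \<Otimes>\<^sub>M M). - (f p \<bullet> v (fst p)))"
    by (intro Bochner_Integration.integral_cong refl) (simp add: case_prod_beta swap)
  also have "(LINT p|(M \<Otimes>\<^sub>M M). f p \<bullet> v (fst p)) - \<dots> = 2 * (LINT p|(M \<Otimes>\<^sub>M M). f p \<bullet> v (fst p))"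
    by simp
  also have "(LINT p|(M \<Otimes>\<^sub>M M). f p \<bullet> v (fst p)) = (LINT x|M. LINT y|M. f (x, y) \<bullet> v x)"
    using pair.integral_fst'[OF int1] by simp
  also have "\<dots> = (LINT x|M. (LINT y|M. f (x, y)) \<bullet> v x)"
  proof (intro Bochner_Integration.integral_cong refl)
    fix x assume "x \<in> space M"
    have "integrable M (\<lambda>y. f (x, y))"
      using truncated_kernel_integrable(1)[OF w \<open>x \<in> space M\<close>] by (simp add: f_def delta_def)
    then show "(LINT y|M. f (x, y) \<bullet> v x) = (LINT y|M. f (x, y)) \<bullet> v x" by simp
  qed
  also have "2 * \<dots> = (LINT x|M. truncated_laplacian n w x \<bullet> v x)"
    by (simp add: truncated_laplacian_def f_def delta_def)
  finally show ?thesis .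
qed

text \<open>The part of \<open>delta w\<close> where the kernel exceeds n tends to 0 in the weighted
  L2 space by dominated convergence, the kernel being finite at every point. Cauchy-Schwarz then
  makes the estimate uniform in v.\<close>

lemma truncated_form_tail:
  assumes w: "w \<in> H_half \<Gamma>" and "\<epsilon> > 0"
  obtains n where "\<And>v. v \<in> H_half \<Gamma> \<Longrightarrow>
    \<bar>(LINT p|pair_weighted. delta w p \<bullet> delta v p) - (LINT p|(M \<Otimes>\<^sub>M M). truncated_kernel n p * (delta w p \<bullet> delta v p))\<bar>
      \<le> \<epsilon> * H_half_norm \<Gamma> v"
proof -
  note [measurable] = H_half_measurable[OF w]
  define tail where "tail n p = (if slobodeckij_kernel p \<le> real n then 0 else delta w p)" for n p
  have [measurable]: "tail n \<in> borel_measurable pair_weighted" for n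
    unfolding tail_def by measurable
  have "(\<lambda>n. LINT p|pair_weighted. tail n p \<bullet> tail n p) \<longlonglongrightarrow> (LINT p|pair_weighted. 0)"
  proof (rule integral_dominated_convergence)
    show "integrable pair_weighted (\<lambda>p. delta w p \<bullet> delta w p)"
      by (rule H_half_inner_integrable[OF w w])
    show "AE p in pair_weighted. (\<lambda>n. tail n p \<bullet> tail n p) \<longlonglongrightarrow> 0"
    proof (intro AE_I2 tendsto_eventually)
      fix p
      obtain n0 where "slobodeckij_kernel p \<le> real n0" using real_arch_simple by blast
      then show "\<forall>\<^sub>F n in sequentially. tail n p \<bullet> tail n p = 0"
        by (intro eventually_sequentiallyI[of n0]) (auto simp: tail_def)
    qed
  qed (auto simp: tail_def)
  then have "\<forall>\<^sub>F n in sequentially. (LINT p|pair_weighted. tail n p \<bullet> tail n p) < \<epsilon>\<^sup>2"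
    using \<open>\<epsilon> > 0\<close> by (intro order_tendstoD(2)[of _ 0]) auto
  then obtain n where n: "(LINT p|pair_weighted. tail n p \<bullet> tail n p) < \<epsilon>\<^sup>2"
    by (auto simp: eventually_sequentially)
  have "\<bar>(LINT p|pair_weighted. delta w p \<bullet> delta v p) - (LINT p|(M \<Otimes>\<^sub>M M). truncated_kernel n p * (delta w p \<bullet> delta v p))\<bar>
      \<le> \<epsilon> * H_half_norm \<Gamma> v" if v: "v \<in> H_half \<Gamma>" for v
  proof -
    note [measurable] = H_half_measurable[OF v]
    let ?c = "\<lambda>p. if slobodeckij_kernel p \<le> real n then 1 else 0 :: real"
    have int: "integrable pair_weighted (\<lambda>p. delta w p \<bullet> delta v p)"
      by (rule H_half_inner_integrable[OF w v])
    have int': "integrable pair_weighted (\<lambda>p. ?c p * (delta w p \<bullet> delta v p))"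
      by (rule Bochner_Integration.integrable_bound[OF int]) auto
    have "(LINT p|pair_weighted. ?c p * (delta w p \<bullet> delta v p))
      = (LINT p|(M \<Otimes>\<^sub>M M). slobodeckij_kernel p *\<^sub>R (?c p * (delta w p \<bullet> delta v p)))"
      unfolding pair_weighted_def by (rule integral_density) auto
    also have "\<dots> = (LINT p|(M \<Otimes>\<^sub>M M). truncated_kernel n p * (delta w p \<bullet> delta v p))"
      by (intro Bochner_Integration.integral_cong refl) (auto simp: truncated_kernel_def)
    finally have "(LINT p|pair_weighted. delta w p \<bullet> delta v p) - (LINT p|(M \<Otimes>\<^sub>M M). truncated_kernel n p * (delta w p \<bullet> delta v p))
      = (LINT p|pair_weighted. delta w p \<bullet> delta v p - ?c p * (delta w p \<bullet> delta v p))"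
      using int int' by simp
    also have "\<dots> = (LINT p|pair_weighted. tail n p \<bullet> delta v p)"
      by (intro Bochner_Integration.integral_cong refl) (auto simp: tail_def)
    also have "\<bar>\<dots>\<bar> \<le> sqrt (LINT p|pair_weighted. tail n p \<bullet> tail n p) * sqrt (LINT p|pair_weighted. delta v p \<bullet> delta v p)"
    proof (rule integral_inner_Cauchy_Schwarz)
      have "(\<integral>\<^sup>+p. ennreal ((cmod (tail n p))\<^sup>2) \<partial>pair_weighted) \<le> (\<integral>\<^sup>+p. ennreal ((cmod (delta w p))\<^sup>2) \<partial>pair_weighted)"
        by (intro nn_integral_mono) (auto simp: tail_def)
      also have "\<dots> < \<infinity>" using w by (simp add: H_half_iff)
      finally show "(\<integral>\<^sup>+p. ennreal ((cmod (tail n p))\<^sup>2) \<partial>pair_weighted) < \<infinity>" .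
      show "(\<integral>\<^sup>+p. ennreal ((cmod (delta v p))\<^sup>2) \<partial>pair_weighted) < \<infinity>" using v by (simp add: H_half_iff)
    qed auto
    also have "\<dots> \<le> \<epsilon> * H_half_norm \<Gamma> v"
    proof (rule mult_mono)
      show "sqrt (LINT p|pair_weighted. tail n p \<bullet> tail n p) \<le> \<epsilon>"
        using n \<open>\<epsilon> > 0\<close> by (intro real_le_lsqrt) auto
      have "(LINT p|pair_weighted. delta v p \<bullet> delta v p) \<le> H_half_inner v v"
        unfolding H_half_inner_def by (simp add: integral_nonneg_AE)
      then show "sqrt (LINT p|pair_weighted. delta v p \<bullet> delta v p) \<le> H_half_norm \<Gamma> v"
        unfolding H_half_inner_self[OF v, symmetric] by simp
    qed (use \<open>\<epsilon> > 0\<close> in \<open>auto intro!: integral_nonneg_AE\<close>)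
    finally show ?thesis .
  qed
  then show thesis by (rule that)
qed

section \<open>Approximation of functionals by square integrable densities\<close>

lemma H_mhalf_linear:
  assumes "\<psi> \<in> H_mhalf \<Gamma>" "u \<in> H_half \<Gamma>" "v \<in> H_half \<Gamma>"
  shows "\<psi> (\<lambda>x. u x + a * v x) = \<psi> u + cnj a * \<psi> v"
  using assms H_half_cmult[of v a] unfolding H_mhalf_def by auto

text \<open>Half of \<epsilon> pays for replacing the functional by the inner product with w, the
  other half for truncating the kernel. What remains is the pairing with the density w + h, where h
  is the truncated operator applied to w.\<close>

lemma L2_dense_H_mhalf:
  assumes \<psi>: "\<psi> \<in> H_mhalf \<Gamma>" and "\<epsilon> > 0"
  obtains g where "g \<in> L2_space \<Gamma>"
    "\<And>v. v \<in> H_half \<Gamma> \<Longrightarrow> cmod (\<psi> v - of_density \<Gamma> g v) \<le> \<epsilon> * H_half_norm \<Gamma> v"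
proof -
  obtain K where K: "\<And>u. u \<in> H_half \<Gamma> \<Longrightarrow> cmod (\<psi> u) \<le> K * H_half_norm \<Gamma> u"
    using \<psi> unfolding H_mhalf_def by blast
  obtain w where w: "w \<in> H_half \<Gamma>"
    "\<And>v. v \<in> H_half \<Gamma> \<Longrightarrow> \<bar>Re (\<psi> v) - H_half_inner w v\<bar> \<le> \<epsilon> / 2 * sqrt (H_half_inner v v)"
  proof (rule approximate_riesz[of "H_half \<Gamma>" H_half_inner "\<lambda>v. Re (\<psi> v)" K "\<epsilon> / 2"])
    fix u assume u: "u \<in> H_half \<Gamma>"
    show "\<bar>Re (\<psi> u)\<bar> \<le> K * sqrt (H_half_inner u u)"
      using K[OF u] abs_Re_le_cmod[of "\<psi> u"] by (simp add: H_half_inner_self[OF u])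
    show "0 \<le> H_half_inner u u"
      unfolding H_half_inner_def by (intro add_nonneg_nonneg integral_nonneg_AE) auto
  qed (use \<open>\<epsilon> > 0\<close> H_half_zero in \<open>auto simp: H_half_inner_add_cmult H_mhalf_linear[OF \<psi>] intro!: H_half_add H_half_cmult\<close>)
  obtain n where n: "\<And>v. v \<in> H_half \<Gamma> \<Longrightarrow>
    \<bar>(LINT p|pair_weighted. delta w p \<bullet> delta v p) - (LINT p|(M \<Otimes>\<^sub>M M). truncated_kernel n p * (delta w p \<bullet> delta v p))\<bar>
      \<le> \<epsilon> / 2 * H_half_norm \<Gamma> v"
    using truncated_form_tail[OF w(1), of "\<epsilon> / 2"] \<open>\<epsilon> > 0\<close> by auto
  define h where "h = truncated_laplacian n w"
  define g where "g x = w x + h x" for x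
  have w2: "w \<in> L2_space \<Gamma>" by (rule H_half_subset_L2[OF w(1)])
  have h2: "h \<in> L2_space \<Gamma>" unfolding h_def by (rule truncated_laplacian_L2[OF w2])
  have g2: "g \<in> L2_space \<Gamma>" unfolding g_def by (rule L2_add[OF w2 h2])
  have Re: "\<bar>Re (\<psi> v - of_density \<Gamma> g v)\<bar> \<le> \<epsilon> * H_half_norm \<Gamma> v" if v: "v \<in> H_half \<Gamma>" for v
  proof -
    have v2: "v \<in> L2_space \<Gamma>" by (rule H_half_subset_L2[OF v])
    have int: "integrable M (\<lambda>x. w x \<bullet> v x)" "integrable M (\<lambda>x. h x \<bullet> v x)"
      using v2 w2 h2 by (auto simp: L2_space_def intro!: integrable_inner_sq)
    have "Re (of_density \<Gamma> g v) = (LINT x|M. w x \<bullet> v x) + (LINT x|M. h x \<bullet> v x)"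
      unfolding Re_of_density[OF g2 v2] g_def inner_add_left using int by simp
    also have "(LINT x|M. h x \<bullet> v x) = (LINT p|(M \<Otimes>\<^sub>M M). truncated_kernel n p * (delta w p \<bullet> delta v p))"
      unfolding h_def by (rule integral_truncated_form[OF w2 v2, symmetric])
    finally have "Re (\<psi> v - of_density \<Gamma> g v) = Re (\<psi> v) - (LINT x|M. w x \<bullet> v x)
      - (LINT p|(M \<Otimes>\<^sub>M M). truncated_kernel n p * (delta w p \<bullet> delta v p))" by simp
    moreover have "\<epsilon> / 2 * H_half_norm \<Gamma> v + \<epsilon> / 2 * H_half_norm \<Gamma> v = \<epsilon> * H_half_norm \<Gamma> v"
      by simp
    ultimately show ?thesis
      using w(2)[OF v] n[OF v] unfolding H_half_inner_self[OF v] H_half_inner_def[of w v]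
      by linarith
  qed
  have "cmod (\<psi> v - of_density \<Gamma> g v) \<le> \<epsilon> * H_half_norm \<Gamma> v" if v: "v \<in> H_half \<Gamma>" for v
  proof (cases "\<psi> v - of_density \<Gamma> g v = 0")
    case False
    define z where "z = \<psi> v - of_density \<Gamma> g v"
    \<comment> \<open>Rotating v by the phase c makes the difference real and nonnegative without
      changing the norm of v, so the bound on real parts gives the bound on moduli. Both functionals
      are conjugate linear, hence the same factor \<open>cnj c\<close>.\<close>
    define c where "c = z / of_real (cmod z)"
    have c: "cmod c = 1" "cnj c * z = of_real (cmod z)"
      using False complex_norm_square[of z]
      by (auto simp: c_def z_def norm_divide power2_eq_square divide_simps mult.commute)
    have "\<psi> (\<lambda>x. c * v x) = cnj c * \<psi> v" using \<psi> v unfolding H_mhalf_def by blast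
    moreover have "of_density \<Gamma> g (\<lambda>x. c * v x) = cnj c * of_density \<Gamma> g v"
      unfolding of_density_def by (simp add: mult.left_commute)
    ultimately have "\<psi> (\<lambda>x. c * v x) - of_density \<Gamma> g (\<lambda>x. c * v x) = of_real (cmod z)"
      using c(2) by (simp add: z_def right_diff_distrib)
    then show ?thesis
      using Re[OF H_half_cmult[OF v, of c]] c(1) by (simp add: H_half_norm_cmult[OF v] z_def)
  qed (use \<open>\<epsilon> > 0\<close> in simp)
  then show thesis using g2 that by blast
qed

end

section \<open>Operators between the Sobolev spaces\<close>

context finite_surface begin

lemma H_mhalf_add: "\<psi> \<in> H_mhalf \<Gamma> \<Longrightarrow> u \<in> H_half \<Gamma> \<Longrightarrow> v \<in> H_half \<Gamma> \<Longrightarrow>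
    \<psi> (\<lambda>x. u x + v x) = \<psi> u + \<psi> v"
  and H_mhalf_cmult: "\<psi> \<in> H_mhalf \<Gamma> \<Longrightarrow> u \<in> H_half \<Gamma> \<Longrightarrow> \<psi> (\<lambda>x. a * u x) = cnj a * \<psi> u"
  unfolding H_mhalf_def by blast+

lemma H_mhalf_bdd_above:
  assumes "\<psi> \<in> H_mhalf \<Gamma>"
  shows "bdd_above ((\<lambda>u. cmod (\<psi> u)) ` {u \<in> H_half \<Gamma>. H_half_norm \<Gamma> u \<le> 1})"
proof -
  obtain K where K: "\<And>u. u \<in> H_half \<Gamma> \<Longrightarrow> cmod (\<psi> u) \<le> K * H_half_norm \<Gamma> u"
    using assms unfolding H_mhalf_def by blast
  show ?thesis
  proof (rule bdd_aboveI2)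
    fix u assume u: "u \<in> {u \<in> H_half \<Gamma>. H_half_norm \<Gamma> u \<le> 1}"
    have "cmod (\<psi> u) \<le> K * H_half_norm \<Gamma> u" using K u by simp
    also have "\<dots> \<le> \<bar>K\<bar> * 1" using u by (intro mult_mono) auto
    finally show "cmod (\<psi> u) \<le> \<bar>K\<bar>" by simp
  qed
qed

lemma H_mhalf_norm_bound:
  assumes \<psi>: "\<psi> \<in> H_mhalf \<Gamma>" and u: "u \<in> H_half \<Gamma>"
  shows "cmod (\<psi> u) \<le> H_mhalf_norm \<Gamma> \<psi> * H_half_norm \<Gamma> u"
proof -
  obtain K where K: "\<And>u. u \<in> H_half \<Gamma> \<Longrightarrow> cmod (\<psi> u) \<le> K * H_half_norm \<Gamma> u"
    using \<psi> unfolding H_mhalf_def by blast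
  show ?thesis
  proof (cases "H_half_norm \<Gamma> u = 0")
    case True
    \<comment> \<open>A test function of norm 0 cannot be normalised; here the boundedness constant
      forces the functional to vanish on it.\<close>
    then show ?thesis using K[OF u] by simp
  next
    case False
    define s where "s = H_half_norm \<Gamma> u"
    have s: "s > 0" using False by (simp add: s_def order.not_eq_order_implies_strict)
    define v where "v = (\<lambda>x. of_real (1 / s) * u x)"
    have v: "v \<in> H_half \<Gamma>" unfolding v_def by (rule H_half_cmult[OF u])
    have v_norm: "H_half_norm \<Gamma> v \<le> 1"
      using s H_half_norm_cmult[OF u, of "of_real (1 / s)"] by (simp add: v_def norm_divide flip: s_def)
    have "cmod (\<psi> v) \<le> H_mhalf_norm \<Gamma> \<psi>"
      unfolding H_mhalf_norm_def by (rule cSUP_upper[OF _ H_mhalf_bdd_above[OF \<psi>]]) (use v v_norm in simp)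
    moreover have "\<psi> v = cnj (of_real (1 / s)) * \<psi> u"
      unfolding v_def by (rule H_mhalf_cmult[OF \<psi> u])
    ultimately show ?thesis
      using s by (simp add: norm_divide field_simps flip: s_def)
  qed
qed

lemma H_mhalf_norm_le:
  assumes "\<And>u. u \<in> H_half \<Gamma> \<Longrightarrow> cmod (\<psi> u) \<le> K * H_half_norm \<Gamma> u" "K \<ge> 0"
  shows "H_mhalf_norm \<Gamma> \<psi> \<le> K"
  unfolding H_mhalf_norm_def
proof (rule cSUP_least)
  have "H_half_norm \<Gamma> (\<lambda>_. 0) = 0" using H_half_norm_eq_0_iff[OF H_half_zero] by simp
  then show "{u \<in> H_half \<Gamma>. H_half_norm \<Gamma> u \<le> 1} \<noteq> {}"
    using H_half_zero by force
  fix u assume u: "u \<in> {u \<in> H_half \<Gamma>. H_half_norm \<Gamma> u \<le> 1}"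
  have "cmod (\<psi> u) \<le> K * H_half_norm \<Gamma> u" using assms(1) u by simp
  also have "\<dots> \<le> K * 1" using u assms(2) by (intro mult_left_mono) auto
  finally show "cmod (\<psi> u) \<le> K" by simp
qed

lemma H_mhalf_norm_nonneg:
  assumes "\<psi> \<in> H_mhalf \<Gamma>"
  shows "0 \<le> H_mhalf_norm \<Gamma> \<psi>"
proof -
  have "H_half_norm \<Gamma> (\<lambda>_. 0) = 0" using H_half_norm_eq_0_iff[OF H_half_zero] by simp
  then have "cmod (\<psi> (\<lambda>_. 0)) \<le> H_mhalf_norm \<Gamma> \<psi>"
    unfolding H_mhalf_norm_def
    by (intro cSUP_upper H_mhalf_bdd_above assms) (use H_half_zero in simp)
  then show ?thesis using norm_ge_zero order.trans by blast
qed

lemma H_mhalf_norm_eq_0_iff: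
  assumes "\<psi> \<in> H_mhalf \<Gamma>"
  shows "H_mhalf_norm \<Gamma> \<psi> = 0 \<longleftrightarrow> (\<forall>u\<in>H_half \<Gamma>. \<psi> u = 0)"
proof
  assume "H_mhalf_norm \<Gamma> \<psi> = 0"
  then show "\<forall>u\<in>H_half \<Gamma>. \<psi> u = 0" using H_mhalf_norm_bound[OF assms] by fastforce
next
  assume "\<forall>u\<in>H_half \<Gamma>. \<psi> u = 0"
  then show "H_mhalf_norm \<Gamma> \<psi> = 0"
    using H_mhalf_norm_le[of \<psi> 0] H_mhalf_norm_nonneg[OF assms] by fastforce
qed

lemma H_mhalf_lincomb:
  assumes f: "f \<in> H_mhalf \<Gamma>" and g: "g \<in> H_mhalf \<Gamma>"
  shows "(\<lambda>u. a * f u + b * g u) \<in> H_mhalf \<Gamma>"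
  unfolding H_mhalf_def
proof (safe intro!: exI[of _ "cmod a * H_mhalf_norm \<Gamma> f + cmod b * H_mhalf_norm \<Gamma> g"])
  fix u v assume "u \<in> H_half \<Gamma>" "v \<in> H_half \<Gamma>"
  then show "a * f (\<lambda>x. u x + v x) + b * g (\<lambda>x. u x + v x) = a * f u + b * g u + (a * f v + b * g v)"
    by (simp add: H_mhalf_add[OF f] H_mhalf_add[OF g] distrib_left)
next
  fix c u assume "u \<in> H_half \<Gamma>"
  then show "a * f (\<lambda>x. c * u x) + b * g (\<lambda>x. c * u x) = cnj c * (a * f u + b * g u)"
    by (simp add: H_mhalf_cmult[OF f] H_mhalf_cmult[OF g] algebra_simps)
next
  fix u assume u: "u \<in> H_half \<Gamma>"
  have "cmod (a * f u + b * g u) \<le> cmod a * cmod (f u) + cmod b * cmod (g u)"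
    using norm_triangle_ineq[of "a * f u" "b * g u"] by (simp add: norm_mult)
  also have "\<dots> \<le> cmod a * (H_mhalf_norm \<Gamma> f * H_half_norm \<Gamma> u) + cmod b * (H_mhalf_norm \<Gamma> g * H_half_norm \<Gamma> u)"
    using H_mhalf_norm_bound[OF f u] H_mhalf_norm_bound[OF g u] by (intro add_mono mult_left_mono) auto
  finally show "cmod (a * f u + b * g u) \<le> (cmod a * H_mhalf_norm \<Gamma> f + cmod b * H_mhalf_norm \<Gamma> g) * H_half_norm \<Gamma> u"
    by (simp add: algebra_simps)
qed

lemma H_mhalf_closed:
  assumes "f \<in> H_mhalf \<Gamma>" "g \<in> H_mhalf \<Gamma>"
  shows "(\<lambda>u. f u + g u) \<in> H_mhalf \<Gamma>" "(\<lambda>u. f u - g u) \<in> H_mhalf \<Gamma>" "(\<lambda>u. a * f u) \<in> H_mhalf \<Gamma>"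
  using H_mhalf_lincomb[OF assms, of 1 1] H_mhalf_lincomb[OF assms, of 1 "-1"]
    H_mhalf_lincomb[OF assms, of a 0] by simp_all

lemma of_density_H_mhalf:
  assumes g: "g \<in> L2_space \<Gamma>"
  shows "of_density \<Gamma> g \<in> H_mhalf \<Gamma>"
  unfolding H_mhalf_def
proof (safe intro!: exI[of _ "sqrt (LINT x|M. (cmod (g x))\<^sup>2)"])
  fix u v assume "u \<in> H_half \<Gamma>" "v \<in> H_half \<Gamma>"
  then show "of_density \<Gamma> g (\<lambda>x. u x + v x) = of_density \<Gamma> g u + of_density \<Gamma> g v"
    using L2_integrable_mult_cnj[OF g H_half_subset_L2] by (simp add: of_density_def distrib_left)
next
  fix c u
  show "of_density \<Gamma> g (\<lambda>x. c * u x) = cnj c * of_density \<Gamma> g u"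
    by (simp add: of_density_def mult.left_commute)
next
  fix u assume u: "u \<in> H_half \<Gamma>"
  note u2 = H_half_subset_L2[OF u]
  note [measurable] = L2_measurable[OF g] L2_measurable[OF u2]
  have "cmod (of_density \<Gamma> g u) \<le> (LINT x|M. cmod (g x * cnj (u x)))"
    unfolding of_density_def by (rule integral_norm_bound)
  \<comment> \<open>The moduli are embedded into the complex numbers so that the real inner product
    form of Cauchy-Schwarz bounds the integral of the product of moduli.\<close>
  also have "\<dots> = (LINT x|M. complex_of_real (cmod (g x)) \<bullet> complex_of_real (cmod (u x)))"
    by (simp add: norm_mult inner_complex_def)
  also have "\<dots> \<le> \<bar>\<dots>\<bar>" by simp
  also have "\<dots> \<le> sqrt (LINT x|M. complex_of_real (cmod (g x)) \<bullet> complex_of_real (cmod (g x)))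
      * sqrt (LINT x|M. complex_of_real (cmod (u x)) \<bullet> complex_of_real (cmod (u x)))"
    using g u2 by (intro integral_inner_Cauchy_Schwarz) (auto simp: L2_space_def)
  also have "\<dots> = sqrt (LINT x|M. (cmod (g x))\<^sup>2) * sqrt (LINT x|M. (cmod (u x))\<^sup>2)"
    by (simp add: inner_complex_def power2_eq_square)
  also have "\<dots> \<le> sqrt (LINT x|M. (cmod (g x))\<^sup>2) * H_half_norm \<Gamma> u"
  proof (rule mult_left_mono)
    have "(LINT x|M. (cmod (u x))\<^sup>2) \<le> H_half_inner u u"
      unfolding H_half_inner_def by (simp add: dot_square_norm integral_nonneg_AE)
    then show "sqrt (LINT x|M. (cmod (u x))\<^sup>2) \<le> H_half_norm \<Gamma> u"
      unfolding H_half_inner_self[OF u, symmetric] by simp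
  qed (simp add: integral_nonneg_AE)
  finally show "cmod (of_density \<Gamma> g u) \<le> sqrt (LINT x|M. (cmod (g x))\<^sup>2) * H_half_norm \<Gamma> u" .
qed

abbreviation op_mhalf_half where
  "op_mhalf_half \<equiv> bounded_op (H_mhalf \<Gamma>) (H_mhalf_norm \<Gamma>) (H_half \<Gamma>) (H_half_norm \<Gamma>)"

abbreviation op_half_mhalf where
  "op_half_mhalf \<equiv> bounded_op (H_half \<Gamma>) (H_half_norm \<Gamma>) (H_mhalf \<Gamma>) (H_mhalf_norm \<Gamma>)"

text \<open>The working form of boundedness: linearity almost everywhere, and a nonnegative constant
  so that estimates may be multiplied by it.\<close>

lemma op_mhalf_half_iff:
  "op_mhalf_half S \<longleftrightarrow>
    (\<forall>f\<in>H_mhalf \<Gamma>. S f \<in> H_half \<Gamma>) \<and>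
    (\<forall>f\<in>H_mhalf \<Gamma>. \<forall>g\<in>H_mhalf \<Gamma>. AE x in M. S (\<lambda>u. f u + g u) x = S f x + S g x) \<and>
    (\<forall>a. \<forall>f\<in>H_mhalf \<Gamma>. AE x in M. S (\<lambda>u. a * f u) x = a * S f x) \<and>
    (\<exists>K\<ge>0. \<forall>f\<in>H_mhalf \<Gamma>. H_half_norm \<Gamma> (S f) \<le> K * H_mhalf_norm \<Gamma> f)"
    (is "_ \<longleftrightarrow> ?mem \<and> ?add \<and> ?cmult \<and> ?bound")
proof -
  have K: "(\<exists>K. \<forall>f\<in>H_mhalf \<Gamma>. H_half_norm \<Gamma> (S f) \<le> K * H_mhalf_norm \<Gamma> f) \<longleftrightarrow> ?bound"
  proof
    assume "\<exists>K. \<forall>f\<in>H_mhalf \<Gamma>. H_half_norm \<Gamma> (S f) \<le> K * H_mhalf_norm \<Gamma> f"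
    then obtain K where K: "\<forall>f\<in>H_mhalf \<Gamma>. H_half_norm \<Gamma> (S f) \<le> K * H_mhalf_norm \<Gamma> f" by blast
    have "H_half_norm \<Gamma> (S f) \<le> \<bar>K\<bar> * H_mhalf_norm \<Gamma> f" if "f \<in> H_mhalf \<Gamma>" for f
      using K that mult_right_mono[OF abs_ge_self[of K] H_mhalf_norm_nonneg[OF that]] by fastforce
    then show ?bound by (intro exI[of _ "\<bar>K\<bar>"]) auto
  qed blast
  have mem: "S \<in> H_mhalf \<Gamma> \<rightarrow> H_half \<Gamma> \<longleftrightarrow> ?mem" by blast
  have *: "(\<forall>f\<in>H_mhalf \<Gamma>. \<forall>g\<in>H_mhalf \<Gamma>. H_half_norm \<Gamma> (\<lambda>x. S (\<lambda>u. f u + g u) x - (S f x + S g x)) = 0) \<longleftrightarrow> ?add"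
    "(\<forall>a. \<forall>f\<in>H_mhalf \<Gamma>. H_half_norm \<Gamma> (\<lambda>x. S (\<lambda>u. a * f u) x - a * S f x) = 0) \<longleftrightarrow> ?cmult" if ?mem
  proof -
    have "H_half_norm \<Gamma> (\<lambda>x. S (\<lambda>u. f u + g u) x - (S f x + S g x)) = 0
      \<longleftrightarrow> (AE x in M. S (\<lambda>u. f u + g u) x = S f x + S g x)" if "f \<in> H_mhalf \<Gamma>" "g \<in> H_mhalf \<Gamma>" for f g
      using \<open>?mem\<close> that by (subst H_half_norm_eq_0_iff) (auto intro!: H_half_diff H_half_add H_mhalf_closed)
    then show "(\<forall>f\<in>H_mhalf \<Gamma>. \<forall>g\<in>H_mhalf \<Gamma>. H_half_norm \<Gamma> (\<lambda>x. S (\<lambda>u. f u + g u) x - (S f x + S g x)) = 0) \<longleftrightarrow> ?add"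
      by blast
    have "H_half_norm \<Gamma> (\<lambda>x. S (\<lambda>u. a * f u) x - a * S f x) = 0
      \<longleftrightarrow> (AE x in M. S (\<lambda>u. a * f u) x = a * S f x)" if "f \<in> H_mhalf \<Gamma>" for a f
      using \<open>?mem\<close> that by (subst H_half_norm_eq_0_iff) (auto intro!: H_half_diff H_half_cmult H_mhalf_closed)
    then show "(\<forall>a. \<forall>f\<in>H_mhalf \<Gamma>. H_half_norm \<Gamma> (\<lambda>x. S (\<lambda>u. a * f u) x - a * S f x) = 0) \<longleftrightarrow> ?cmult"
      by blast
  qed
  show ?thesis unfolding bounded_op_def mem K using * by blast
qed

lemma op_mhalf_half_D:
  assumes "op_mhalf_half S"
  shows "f \<in> H_mhalf \<Gamma> \<Longrightarrow> S f \<in> H_half \<Gamma>"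
    and "f \<in> H_mhalf \<Gamma> \<Longrightarrow> g \<in> H_mhalf \<Gamma> \<Longrightarrow> AE x in M. S (\<lambda>u. f u + g u) x = S f x + S g x"
    and "f \<in> H_mhalf \<Gamma> \<Longrightarrow> AE x in M. S (\<lambda>u. a * f u) x = a * S f x"
  using assms unfolding op_mhalf_half_iff by simp_all

text \<open>The dual norm sees a functional only on \<open>H_half\<close>, so linearity holds at
  such test functions. The last claim, that the value depends only on the almost-everywhere class of
  the argument, comes from boundedness.\<close>

lemma op_half_mhalf_D:
  assumes "op_half_mhalf T"
  shows "f \<in> H_half \<Gamma> \<Longrightarrow> T f \<in> H_mhalf \<Gamma>"
    and "f \<in> H_half \<Gamma> \<Longrightarrow> g \<in> H_half \<Gamma> \<Longrightarrow> u \<in> H_half \<Gamma> \<Longrightarrow> T (\<lambda>x. f x + g x) u = T f u + T g u"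
    and "f \<in> H_half \<Gamma> \<Longrightarrow> u \<in> H_half \<Gamma> \<Longrightarrow> T (\<lambda>x. a * f x) u = a * T f u"
    and "f \<in> H_half \<Gamma> \<Longrightarrow> g \<in> H_half \<Gamma> \<Longrightarrow> u \<in> H_half \<Gamma> \<Longrightarrow> AE x in M. f x = g x \<Longrightarrow> T f u = T g u"
proof -
  show mem: "T f \<in> H_mhalf \<Gamma>" if "f \<in> H_half \<Gamma>" for f
    using assms that unfolding bounded_op_def by blast
  show add: "T (\<lambda>x. f x + g x) u = T f u + T g u"
    if "f \<in> H_half \<Gamma>" "g \<in> H_half \<Gamma>" "u \<in> H_half \<Gamma>" for f g u
  proof -
    have "H_mhalf_norm \<Gamma> (\<lambda>u. T (\<lambda>x. f x + g x) u - (T f u + T g u)) = 0"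
      using assms that unfolding bounded_op_def by blast
    then show ?thesis
      using that by (subst (asm) H_mhalf_norm_eq_0_iff) (auto intro!: H_mhalf_closed mem H_half_add)
  qed
  show "T (\<lambda>x. a * f x) u = a * T f u" if "f \<in> H_half \<Gamma>" "u \<in> H_half \<Gamma>"
  proof -
    have "H_mhalf_norm \<Gamma> (\<lambda>u. T (\<lambda>x. a * f x) u - a * T f u) = 0"
      using assms that unfolding bounded_op_def by blast
    then show ?thesis
      using that by (subst (asm) H_mhalf_norm_eq_0_iff) (auto intro!: H_mhalf_closed mem H_half_cmult)
  qed
  show "T f u = T g u" if "f \<in> H_half \<Gamma>" "g \<in> H_half \<Gamma>" "u \<in> H_half \<Gamma>" "AE x in M. f x = g x"
  proof -
    have d: "(\<lambda>x. f x - g x) \<in> H_half \<Gamma>" using that by (intro H_half_diff)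
    obtain K where "H_mhalf_norm \<Gamma> (T (\<lambda>x. f x - g x)) \<le> K * H_half_norm \<Gamma> (\<lambda>x. f x - g x)"
      using assms d unfolding bounded_op_def by blast
    moreover have "H_half_norm \<Gamma> (\<lambda>x. f x - g x) = 0"
      using that(4) H_half_norm_eq_0_iff[OF d] by simp
    ultimately have "H_mhalf_norm \<Gamma> (T (\<lambda>x. f x - g x)) = 0"
      using H_mhalf_norm_nonneg[OF mem[OF d]] by simp
    then have "T (\<lambda>x. f x - g x) u = 0"
      using H_mhalf_norm_eq_0_iff[OF mem[OF d]] that(3) by blast
    then show ?thesis using add[OF d that(2,3)] by simp
  qed
qed

text \<open>The functionals f and g + h may differ outside \<open>H_half\<close>. Their difference k
  has dual norm 0, so boundedness makes its image vanish almost everywhere.\<close>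

lemma op_mhalf_half_add_cong:
  assumes S: "op_mhalf_half S"
    and mem: "f \<in> H_mhalf \<Gamma>" "g \<in> H_mhalf \<Gamma>" "h \<in> H_mhalf \<Gamma>"
    and eq: "\<And>u. u \<in> H_half \<Gamma> \<Longrightarrow> f u = g u + h u"
  shows "AE x in M. S f x = S g x + S h x"
proof -
  define k where "k = (\<lambda>u. f u - (g u + h u))"
  have k: "k \<in> H_mhalf \<Gamma>" unfolding k_def by (intro H_mhalf_closed mem)
  have "H_mhalf_norm \<Gamma> k = 0" unfolding H_mhalf_norm_eq_0_iff[OF k] by (simp add: k_def eq)
  moreover obtain K where "H_half_norm \<Gamma> (S k) \<le> K * H_mhalf_norm \<Gamma> k"
    using S k unfolding op_mhalf_half_iff by blast
  ultimately have "H_half_norm \<Gamma> (S k) = 0" by (simp add: order.antisym)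
  moreover have "S k \<in> H_half \<Gamma>" by (rule op_mhalf_half_D(1)[OF S k])
  ultimately have "AE x in M. S k x = 0" by (simp add: H_half_norm_eq_0_iff)
  moreover have "AE x in M. S (\<lambda>u. k u + (g u + h u)) x = S k x + S (\<lambda>u. g u + h u) x"
    by (rule op_mhalf_half_D(2)[OF S k H_mhalf_closed(1)[OF mem(2,3)]])
  moreover have "AE x in M. S (\<lambda>u. g u + h u) x = S g x + S h x"
    by (rule op_mhalf_half_D(2)[OF S mem(2,3)])
  moreover have "(\<lambda>u. k u + (g u + h u)) = f" by (simp add: k_def)
  ultimately show ?thesis by auto
qed

lemma op_mhalf_half_zero:
  assumes S: "op_mhalf_half S"
  shows "AE x in M. S (\<lambda>_. 0) x = 0"
proof -
  have 0: "(\<lambda>_. 0) \<in> H_mhalf \<Gamma>" by (auto simp: H_mhalf_def intro!: exI[of _ 0])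
  have "AE x in M. S (\<lambda>u. 0 * 0) x = 0 * S (\<lambda>_. 0) x"
    by (rule op_mhalf_half_D(3)[OF S 0])
  then show ?thesis by simp
qed

lemma op_mhalf_half_diff:
  assumes A: "op_mhalf_half A" and B: "op_mhalf_half B"
  shows "op_mhalf_half (\<lambda>f x. A f x - B f x)"
  unfolding op_mhalf_half_iff
proof (intro conjI ballI allI)
  show "(\<lambda>x. A f x - B f x) \<in> H_half \<Gamma>" if "f \<in> H_mhalf \<Gamma>" for f
    by (intro H_half_diff op_mhalf_half_D(1)[OF A that] op_mhalf_half_D(1)[OF B that])
  show "AE x in M. A (\<lambda>u. f u + g u) x - B (\<lambda>u. f u + g u) x = A f x - B f x + (A g x - B g x)"
    if "f \<in> H_mhalf \<Gamma>" "g \<in> H_mhalf \<Gamma>" for f g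
  proof -
    show ?thesis
      using op_mhalf_half_D(2)[OF A that] op_mhalf_half_D(2)[OF B that] by eventually_elim simp
  qed
  show "AE x in M. A (\<lambda>u. a * f u) x - B (\<lambda>u. a * f u) x = a * (A f x - B f x)"
    if "f \<in> H_mhalf \<Gamma>" for a f
  proof -
    show ?thesis
      using op_mhalf_half_D(3)[OF A that, of a] op_mhalf_half_D(3)[OF B that, of a]
      by eventually_elim (simp add: right_diff_distrib)
  qed
  obtain K where K: "K \<ge> 0" "\<And>f. f \<in> H_mhalf \<Gamma> \<Longrightarrow> H_half_norm \<Gamma> (A f) \<le> K * H_mhalf_norm \<Gamma> f"
    using A unfolding op_mhalf_half_iff by blast
  obtain L where L: "L \<ge> 0" "\<And>f. f \<in> H_mhalf \<Gamma> \<Longrightarrow> H_half_norm \<Gamma> (B f) \<le> L * H_mhalf_norm \<Gamma> f"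
    using B unfolding op_mhalf_half_iff by blast
  have "H_half_norm \<Gamma> (\<lambda>x. A f x - B f x) \<le> 2 * (K + L) * H_mhalf_norm \<Gamma> f" if f: "f \<in> H_mhalf \<Gamma>" for f
  proof -
    show ?thesis
      using H_half_norm_diff_le[OF op_mhalf_half_D(1)[OF A f] op_mhalf_half_D(1)[OF B f]] K(2)[OF f] L(2)[OF f]
      by (simp add: algebra_simps)
  qed
  then show "\<exists>K\<ge>0. \<forall>f\<in>H_mhalf \<Gamma>. H_half_norm \<Gamma> (\<lambda>x. A f x - B f x) \<le> K * H_mhalf_norm \<Gamma> f"
    using K(1) L(1) by (intro exI[of _ "2 * (K + L)"]) auto
qed

text \<open>Continuity and density: the principle by which identities checked on densities extend to
  all functionals.\<close>

lemma op_mhalf_half_eq_0: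
  assumes A: "op_mhalf_half A"
    and zero: "\<And>g. g \<in> L2_space \<Gamma> \<Longrightarrow> AE x in M. A (of_density \<Gamma> g) x = 0"
    and \<psi>: "\<psi> \<in> H_mhalf \<Gamma>"
  shows "AE x in M. A \<psi> x = 0"
proof -
  obtain K where K: "K \<ge> 0" "\<And>f. f \<in> H_mhalf \<Gamma> \<Longrightarrow> H_half_norm \<Gamma> (A f) \<le> K * H_mhalf_norm \<Gamma> f"
    using A unfolding op_mhalf_half_iff by blast
  have mem: "A f \<in> H_half \<Gamma>" if "f \<in> H_mhalf \<Gamma>" for f
    by (rule op_mhalf_half_D(1)[OF A that])
  have "H_half_norm \<Gamma> (A \<psi>) \<le> 0 + \<epsilon>" if "\<epsilon> > 0" for \<epsilon>
  proof -
    \<comment> \<open>The 2 absorbs the quasi-triangle inequality, and K + 1 keeps the denominator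
      positive when K = 0.\<close>
    define e where "e = \<epsilon> / (2 * (K + 1))"
    have e: "e > 0" "2 * (K * e) \<le> \<epsilon>" using that K(1) by (auto simp: e_def field_simps)
    obtain g where g: "g \<in> L2_space \<Gamma>"
      "\<And>v. v \<in> H_half \<Gamma> \<Longrightarrow> cmod (\<psi> v - of_density \<Gamma> g v) \<le> e * H_half_norm \<Gamma> v"
      using L2_dense_H_mhalf[OF \<psi> e(1)] by blast
    define d where "d = (\<lambda>u. \<psi> u - of_density \<Gamma> g u)"
    have d: "d \<in> H_mhalf \<Gamma>"
      unfolding d_def by (intro H_mhalf_closed of_density_H_mhalf \<psi> g)
    have "AE x in M. A \<psi> x = A (of_density \<Gamma> g) x + A d x"
      by (rule op_mhalf_half_add_cong[OF A \<psi> of_density_H_mhalf[OF g(1)] d]) (simp add: d_def)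
    then have "AE x in M. A \<psi> x - A d x = 0" using zero[OF g(1)] by eventually_elim simp
    then have "H_half_norm \<Gamma> (\<lambda>x. A \<psi> x - A d x) = 0"
      using H_half_norm_eq_0_iff[OF H_half_diff[OF mem[OF \<psi>] mem[OF d]]] by simp
    then have "H_half_norm \<Gamma> (A \<psi>) \<le> 2 * H_half_norm \<Gamma> (A d)"
      using H_half_norm_add_le[OF H_half_diff[OF mem[OF \<psi>] mem[OF d]] mem[OF d]] by simp
    also have "\<dots> \<le> 2 * (K * e)"
    proof -
      have "H_mhalf_norm \<Gamma> d \<le> e" using g(2) e(1) by (intro H_mhalf_norm_le) (auto simp: d_def)
      then have "K * H_mhalf_norm \<Gamma> d \<le> K * e" using K(1) by (rule mult_left_mono)
      then show ?thesis using K(2)[OF d] by linarith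
    qed
    finally show ?thesis using e(2) by simp
  qed
  then have "H_half_norm \<Gamma> (A \<psi>) \<le> 0" by (rule field_le_epsilon)
  then have "H_half_norm \<Gamma> (A \<psi>) = 0" by (simp add: order.antisym)
  then show ?thesis by (simp add: H_half_norm_eq_0_iff[OF mem[OF \<psi>]])
qed

end

section \<open>Reflection symmetry\<close>

locale symmetric_surface = finite_surface \<Gamma> for \<Gamma> :: "'a::euclidean_space set" +
  fixes R :: "'a \<Rightarrow> 'a"
  assumes dist_R: "dist (R x) (R y) = dist x y"
    and R_R [simp]: "R (R x) = x"
    and image_R: "R ` \<Gamma> = \<Gamma>"
    and borel: "\<Gamma> \<in> sets borel"
begin

lemma measurable_R [measurable]: "R \<in> M \<rightarrow>\<^sub>M M"
  and distr_R: "distr M M R = M"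
  using distr_surface_measure_isometry[of R \<Gamma>] dist_R image_R borel by auto

lemma R_mem_iff: "R x \<in> \<Gamma> \<longleftrightarrow> x \<in> \<Gamma>"
  using image_R R_R by (metis image_eqI)

lemma measurable_comp_R_iff: "(\<lambda>x. u (R x)) \<in> M \<rightarrow>\<^sub>M N \<longleftrightarrow> u \<in> M \<rightarrow>\<^sub>M N"
proof -
  have *: "(\<lambda>x. u (R x)) \<in> M \<rightarrow>\<^sub>M N" if "u \<in> M \<rightarrow>\<^sub>M N" for u
    using measurable_compose[OF measurable_R that] .
  show ?thesis using *[of u] *[of "\<lambda>x. u (R x)", unfolded R_R] by blast
qed

text \<open>If f is not measurable, neither is its composition with R, and both integrals take the
  default value 0. This form applies directly to products with the Green's function.\<close>

lemma integral_comp_R: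
  fixes f :: "'a \<Rightarrow> complex"
  shows "(LINT x|M. f (R x)) = (LINT x|M. f x)"
proof (cases "f \<in> borel_measurable M")
  case True
  then have "integral\<^sup>L (distr M M R) f = (LINT x|M. f (R x))"
    by (intro integral_distr measurable_R)
  then show ?thesis by (simp add: distr_R)
next
  case False
  then have "\<not> integrable M f" "\<not> integrable M (\<lambda>x. f (R x))"
    using measurable_comp_R_iff[of f] by (auto dest: borel_measurable_integrable)
  then show ?thesis by (simp add: not_integrable_integral_eq)
qed

lemma nn_integral_comp_R:
  assumes "f \<in> borel_measurable M"
  shows "(\<integral>\<^sup>+x. f (R x) \<partial>M) = (\<integral>\<^sup>+x. f x \<partial>M)"
  using nn_integral_distr[OF measurable_R, of f] assms by (simp add: distr_R)

lemma AE_comp_R: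
  assumes "AE x in M. Q x"
  shows "AE x in M. Q (R x)"
  by (rule AE_distrD[OF measurable_R]) (unfold distr_R, rule assms)

lemma H_half_sq_comp_R:
  assumes [measurable]: "u \<in> borel_measurable M"
  shows "H_half_sq \<Gamma> (\<lambda>x. u (R x)) = H_half_sq \<Gamma> u"
proof -
  define G where "G p = ennreal (slobodeckij_kernel p) * ennreal ((cmod (delta u p))\<^sup>2)" for p
  have G [measurable]: "G \<in> borel_measurable (M \<Otimes>\<^sub>M M)" unfolding G_def by measurable
  have G_eq: "ennreal ((cmod (u x - u y))\<^sup>2 / dist x y ^ DIM('a)) = G (x, y)" for x y
    by (simp add: G_def slobodeckij_kernel_def delta_def flip: ennreal_mult')
  have "(\<integral>\<^sup>+x. \<integral>\<^sup>+y. ennreal ((cmod (u (R x) - u (R y)))\<^sup>2 / dist x y ^ DIM('a)) \<partial>M \<partial>M)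
    = (\<integral>\<^sup>+x. \<integral>\<^sup>+y. G (R x, R y) \<partial>M \<partial>M)"
    by (simp add: dist_R flip: G_eq)
  also have "\<dots> = (\<integral>\<^sup>+x. \<integral>\<^sup>+y. G (R x, y) \<partial>M \<partial>M)"
  proof (rule nn_integral_cong)
    fix x assume "x \<in> space M"
    then have [measurable]: "R x \<in> space M" by (simp add: R_mem_iff)
    show "(\<integral>\<^sup>+y. G (R x, R y) \<partial>M) = (\<integral>\<^sup>+y. G (R x, y) \<partial>M)"
      by (rule nn_integral_comp_R[of "\<lambda>y. G (R x, y)"]) measurable
  qed
  also have "\<dots> = (\<integral>\<^sup>+x. \<integral>\<^sup>+y. G (x, y) \<partial>M \<partial>M)"
    by (rule nn_integral_comp_R[of "\<lambda>x. \<integral>\<^sup>+y. G (x, y) \<partial>M"]) measurable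
  finally show ?thesis
    using nn_integral_comp_R[of "\<lambda>x. ennreal ((cmod (u x))\<^sup>2)"]
    unfolding H_half_sq_def by (simp add: G_eq)
qed

lemma H_half_comp_R: "u \<in> H_half \<Gamma> \<Longrightarrow> (\<lambda>x. u (R x)) \<in> H_half \<Gamma>"
  and H_half_norm_comp_R: "u \<in> H_half \<Gamma> \<Longrightarrow> H_half_norm \<Gamma> (\<lambda>x. u (R x)) = H_half_norm \<Gamma> u"
  by (auto simp: H_half_def H_half_norm_def H_half_sq_comp_R measurable_comp_R_iff)

lemma L2_comp_R: "g \<in> L2_space \<Gamma> \<Longrightarrow> (\<lambda>x. g (R x)) \<in> L2_space \<Gamma>"
  using nn_integral_comp_R[of "\<lambda>x. ennreal ((cmod (g x))\<^sup>2)"]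
  by (auto simp: L2_space_def measurable_comp_R_iff)

text \<open>The action of the reflection on functionals. As R is a measure preserving involution, it
  sends the functional of a density g to that of g composed with R.\<close>

definition dual_R :: "(('a \<Rightarrow> complex) \<Rightarrow> complex) \<Rightarrow> ('a \<Rightarrow> complex) \<Rightarrow> complex" where
  "dual_R \<psi> u = \<psi> (\<lambda>x. u (R x))"

lemma dual_R_H_mhalf:
  assumes \<psi>: "\<psi> \<in> H_mhalf \<Gamma>"
  shows "dual_R \<psi> \<in> H_mhalf \<Gamma>"
  unfolding H_mhalf_def
proof (safe intro!: exI[of _ "H_mhalf_norm \<Gamma> \<psi>"])
  show "dual_R \<psi> (\<lambda>x. u x + v x) = dual_R \<psi> u + dual_R \<psi> v" if "u \<in> H_half \<Gamma>" "v \<in> H_half \<Gamma>" for u v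
    unfolding dual_R_def by (rule H_mhalf_add[OF \<psi> H_half_comp_R[OF that(1)] H_half_comp_R[OF that(2)]])
  show "dual_R \<psi> (\<lambda>x. a * u x) = cnj a * dual_R \<psi> u" if "u \<in> H_half \<Gamma>" for a u
    unfolding dual_R_def by (rule H_mhalf_cmult[OF \<psi> H_half_comp_R[OF that]])
  show "cmod (dual_R \<psi> u) \<le> H_mhalf_norm \<Gamma> \<psi> * H_half_norm \<Gamma> u" if "u \<in> H_half \<Gamma>" for u
    using H_mhalf_norm_bound[OF \<psi> H_half_comp_R[OF that]]
    by (simp add: dual_R_def H_half_norm_comp_R[OF that])
qed

lemma H_mhalf_norm_dual_R:
  assumes \<psi>: "\<psi> \<in> H_mhalf \<Gamma>"
  shows "H_mhalf_norm \<Gamma> (dual_R \<psi>) \<le> H_mhalf_norm \<Gamma> \<psi>"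
  using H_mhalf_norm_bound[OF \<psi> H_half_comp_R] H_mhalf_norm_nonneg[OF \<psi>]
  by (intro H_mhalf_norm_le) (auto simp: dual_R_def H_half_norm_comp_R)

lemma dual_R_of_density: "dual_R (of_density \<Gamma> g) = of_density \<Gamma> (\<lambda>x. g (R x))"
proof
  fix u
  show "dual_R (of_density \<Gamma> g) u = of_density \<Gamma> (\<lambda>x. g (R x)) u"
    using integral_comp_R[of "\<lambda>x. g (R x) * cnj (u x)"] by (simp add: dual_R_def of_density_def)
qed

lemma op_comp_dual_R:
  assumes S: "op_mhalf_half S"
  shows "op_mhalf_half (\<lambda>\<psi>. S (dual_R \<psi>))"
  unfolding op_mhalf_half_iff
proof (intro conjI ballI allI)
  show "S (dual_R f) \<in> H_half \<Gamma>" if "f \<in> H_mhalf \<Gamma>" for f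
    by (rule op_mhalf_half_D(1)[OF S dual_R_H_mhalf[OF that]])
  show "AE x in M. S (dual_R (\<lambda>u. f u + g u)) x = S (dual_R f) x + S (dual_R g) x"
    if "f \<in> H_mhalf \<Gamma>" "g \<in> H_mhalf \<Gamma>" for f g
    using op_mhalf_half_D(2)[OF S dual_R_H_mhalf[OF that(1)] dual_R_H_mhalf[OF that(2)]]
    by (simp add: dual_R_def[abs_def])
  show "AE x in M. S (dual_R (\<lambda>u. a * f u)) x = a * S (dual_R f) x" if "f \<in> H_mhalf \<Gamma>" for a f
    using op_mhalf_half_D(3)[OF S dual_R_H_mhalf[OF that], of a] by (simp add: dual_R_def[abs_def])
  obtain K where K: "K \<ge> 0" "\<And>f. f \<in> H_mhalf \<Gamma> \<Longrightarrow> H_half_norm \<Gamma> (S f) \<le> K * H_mhalf_norm \<Gamma> f"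
    using S unfolding op_mhalf_half_iff by blast
  have "H_half_norm \<Gamma> (S (dual_R f)) \<le> K * H_mhalf_norm \<Gamma> f" if f: "f \<in> H_mhalf \<Gamma>" for f
    using K(2)[OF dual_R_H_mhalf[OF f]] mult_left_mono[OF H_mhalf_norm_dual_R[OF f] K(1)] by linarith
  then show "\<exists>K\<ge>0. \<forall>f\<in>H_mhalf \<Gamma>. H_half_norm \<Gamma> (S (dual_R f)) \<le> K * H_mhalf_norm \<Gamma> f"
    using K(1) by blast
qed

lemma op_R_comp:
  assumes S: "op_mhalf_half S"
  shows "op_mhalf_half (\<lambda>\<psi> x. S \<psi> (R x))"
  unfolding op_mhalf_half_iff
proof (intro conjI ballI allI)
  show "(\<lambda>x. S f (R x)) \<in> H_half \<Gamma>" if "f \<in> H_mhalf \<Gamma>" for f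
    by (intro H_half_comp_R op_mhalf_half_D(1)[OF S that])
  show "AE x in M. S (\<lambda>u. f u + g u) (R x) = S f (R x) + S g (R x)"
    if "f \<in> H_mhalf \<Gamma>" "g \<in> H_mhalf \<Gamma>" for f g
    by (rule AE_comp_R[OF op_mhalf_half_D(2)[OF S that]])
  show "AE x in M. S (\<lambda>u. a * f u) (R x) = a * S f (R x)" if "f \<in> H_mhalf \<Gamma>" for a f
    by (rule AE_comp_R[OF op_mhalf_half_D(3)[OF S that]])
  obtain K where K: "K \<ge> 0" "\<And>f. f \<in> H_mhalf \<Gamma> \<Longrightarrow> H_half_norm \<Gamma> (S f) \<le> K * H_mhalf_norm \<Gamma> f"
    using S unfolding op_mhalf_half_iff by blast
  then show "\<exists>K\<ge>0. \<forall>f\<in>H_mhalf \<Gamma>. H_half_norm \<Gamma> (\<lambda>x. S f (R x)) \<le> K * H_mhalf_norm \<Gamma> f"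
    using H_half_norm_comp_R[OF op_mhalf_half_D(1)[OF S]] by (intro exI[of _ K]) auto
qed

text \<open>For densities this is a change of variables in the integral, by invariance of the kernel
  under simultaneous reflection; density of L2 does the rest.\<close>

lemma op_dual_R_commute:
  fixes G :: "'a \<Rightarrow> 'a \<Rightarrow> complex"
  assumes S: "op_mhalf_half S"
    and rep: "\<And>g. g \<in> L2_space \<Gamma> \<Longrightarrow> AE x in M. S (of_density \<Gamma> g) x = (LINT y|M. G x y * g y)"
    and G: "\<And>x y. G (R x) (R y) = G x y"
    and \<psi>: "\<psi> \<in> H_mhalf \<Gamma>"
  shows "AE x in M. S (dual_R \<psi>) x = S \<psi> (R x)"
proof -
  have "AE x in M. S (dual_R \<psi>) x - S \<psi> (R x) = 0"
  proof (rule op_mhalf_half_eq_0[OF _ _ \<psi>, where A = "\<lambda>\<psi> x. S (dual_R \<psi>) x - S \<psi> (R x)"])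
    show "op_mhalf_half (\<lambda>\<psi> x. S (dual_R \<psi>) x - S \<psi> (R x))"
      by (intro op_mhalf_half_diff op_comp_dual_R op_R_comp S)
    fix g assume g: "g \<in> L2_space \<Gamma>"
    have eq: "(LINT y|M. G x y * g (R y)) = (LINT y|M. G (R x) y * g y)" for x
      using integral_comp_R[of "\<lambda>y. G (R x) y * g y"] by (simp add: G)
    show "AE x in M. S (dual_R (of_density \<Gamma> g)) x - S (of_density \<Gamma> g) (R x) = 0"
      unfolding dual_R_of_density
      using rep[OF L2_comp_R[OF g]] AE_comp_R[OF rep[OF g]] by eventually_elim (simp add: eq)
  qed
  then show ?thesis by simp
qed

text \<open>Here c is even in its second variable, so its integral against an odd density equals its
  own negative. The kernel G enters only through integrals that are compared with
  themselves.\<close>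

lemma op_eq_on_odd:
  fixes G c :: "'a \<Rightarrow> 'a \<Rightarrow> complex"
  assumes S: "op_mhalf_half S" and S': "op_mhalf_half S'"
    and rep: "\<And>g. g \<in> L2_space \<Gamma> \<Longrightarrow> AE x in M. S (of_density \<Gamma> g) x = (LINT y|M. G x y * g y)"
    and rep': "\<And>g. g \<in> L2_space \<Gamma> \<Longrightarrow>
      AE x in M. S' (of_density \<Gamma> g) x = (LINT y|M. (G x y + c x y) * g y)"
    and c: "\<And>x y. c x (R y) = c x y"
    and c_int: "\<And>x g. x \<in> \<Gamma> \<Longrightarrow> g \<in> L2_space \<Gamma> \<Longrightarrow> integrable M (\<lambda>y. c x y * g y)"
    and \<psi>: "\<psi> \<in> H_mhalf \<Gamma>" and odd: "\<And>u. u \<in> H_half \<Gamma> \<Longrightarrow> dual_R \<psi> u = - \<psi> u"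
  shows "AE x in M. S' \<psi> x = S \<psi> x"
proof -
  define D where "D = (\<lambda>\<psi> x. S' \<psi> x - S \<psi> x)"
  have D: "op_mhalf_half D" unfolding D_def by (intro op_mhalf_half_diff S S')
  have D_odd: "AE x in M. D (of_density \<Gamma> h) x = 0"
    if h: "h \<in> L2_space \<Gamma>" and h_odd: "\<And>x. h (R x) = - h x" for h
  proof -
    have eq: "(LINT y|M. (G x y + c x y) * h y) = (LINT y|M. G x y * h y)" if x: "x \<in> \<Gamma>" for x
    proof -
      have "(LINT y|M. c x y * h y) = (LINT y|M. - (c x y * h y))"
        using integral_comp_R[of "\<lambda>y. c x y * h y"] by (simp add: c h_odd)
      then have c0: "(LINT y|M. c x y * h y) = 0" by simp
      show ?thesis
      \<comment> \<open>Adding the integrable function c h does not change whether G h is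
        integrable. If it is not, both integrals are 0 by convention.\<close>
      proof (cases "integrable M (\<lambda>y. G x y * h y)")
        case True
        then show ?thesis using c_int[OF x h] c0 by (simp add: distrib_right)
      next
        case False
        have "\<not> integrable M (\<lambda>y. (G x y + c x y) * h y)"
        proof
          assume "integrable M (\<lambda>y. (G x y + c x y) * h y)"
          from Bochner_Integration.integrable_diff[OF this c_int[OF x h]] False
          show False by (simp add: distrib_right)
        qed
        with False show ?thesis by (simp add: not_integrable_integral_eq)
      qed
    qed
    show ?thesis
      unfolding D_def using rep[OF h] rep'[OF h] AE_space by eventually_elim (simp add: eq)
  qed
  \<comment> \<open>Odd functionals need not be approximated by odd densities: the operator D
    composed with the antisymmetrisation vanishes on every density, hence everywhere. For odd \<psi>
    the difference and the sum of its values at \<psi> and \<open>dual_R \<psi>\<close> are then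
    both 0, so D vanishes at \<psi>.\<close>
  have "AE x in M. D \<psi> x - D (dual_R \<psi>) x = 0"
  proof (rule op_mhalf_half_eq_0[OF _ _ \<psi>, where A = "\<lambda>\<psi> x. D \<psi> x - D (dual_R \<psi>) x"])
    show "op_mhalf_half (\<lambda>\<psi> x. D \<psi> x - D (dual_R \<psi>) x)"
      by (intro op_mhalf_half_diff op_comp_dual_R D)
    fix g assume g: "g \<in> L2_space \<Gamma>"
    define h where "h x = g x + - 1 * g (R x)" for x
    have h: "h \<in> L2_space \<Gamma>" unfolding h_def by (rule L2_add[OF g L2_cmult[OF L2_comp_R[OF g]]])
    have "AE x in M. D (of_density \<Gamma> g) x = D (of_density \<Gamma> (\<lambda>x. g (R x))) x + D (of_density \<Gamma> h) x"
    proof (rule op_mhalf_half_add_cong[OF D])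
      fix u assume "u \<in> H_half \<Gamma>"
      then have u: "u \<in> L2_space \<Gamma>" by (rule H_half_subset_L2)
      show "of_density \<Gamma> g u = of_density \<Gamma> (\<lambda>x. g (R x)) u + of_density \<Gamma> h u"
        unfolding of_density_def
        using L2_integrable_mult_cnj[OF L2_comp_R[OF g] u] L2_integrable_mult_cnj[OF h u]
        by (simp add: h_def left_diff_distrib flip: Bochner_Integration.integral_add)
    qed (intro of_density_H_mhalf g h L2_comp_R)+
    moreover have "AE x in M. D (of_density \<Gamma> h) x = 0" by (rule D_odd[OF h]) (simp add: h_def)
    ultimately show "AE x in M. D (of_density \<Gamma> g) x - D (dual_R (of_density \<Gamma> g)) x = 0"
      unfolding dual_R_of_density by eventually_elim simp
  qed
  moreover have "AE x in M. D (\<lambda>_. 0) x = D \<psi> x + D (dual_R \<psi>) x"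
    by (rule op_mhalf_half_add_cong[OF D _ \<psi> dual_R_H_mhalf[OF \<psi>]])
      (auto simp: odd H_mhalf_def intro!: exI[of _ 0])
  moreover have "AE x in M. D (\<lambda>_. 0) x = 0" by (rule op_mhalf_half_zero[OF D])
  ultimately have "AE x in M. D \<psi> x = 0" by eventually_elim simp
  then show ?thesis by (simp add: D_def)
qed

text \<open>The preimage \<psi> inherits oddness: S maps \<psi> plus its reflection to \<phi> plus
  its reflection, which is 0, and T is a left inverse. Then S and S' agree at \<psi>, and applying
  T' identifies \<psi> with T' \<phi>.\<close>

lemma inverse_eq_on_odd:
  fixes G c :: "'a \<Rightarrow> 'a \<Rightarrow> complex"
  assumes S: "op_mhalf_half S" and S': "op_mhalf_half S'"
    and rep: "\<And>g. g \<in> L2_space \<Gamma> \<Longrightarrow> AE x in M. S (of_density \<Gamma> g) x = (LINT y|M. G x y * g y)"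
    and rep': "\<And>g. g \<in> L2_space \<Gamma> \<Longrightarrow>
      AE x in M. S' (of_density \<Gamma> g) x = (LINT y|M. (G x y + c x y) * g y)"
    and G: "\<And>x y. G (R x) (R y) = G x y"
    and c: "\<And>x y. c x (R y) = c x y"
    and c_int: "\<And>x g. x \<in> \<Gamma> \<Longrightarrow> g \<in> L2_space \<Gamma> \<Longrightarrow> integrable M (\<lambda>y. c x y * g y)"
    and T: "op_half_mhalf T" and T': "op_half_mhalf T'"
    and inv: "inverse_ops (H_mhalf \<Gamma>) (H_mhalf_norm \<Gamma>) (H_half \<Gamma>) (H_half_norm \<Gamma>) S T"
    and inv': "inverse_ops (H_mhalf \<Gamma>) (H_mhalf_norm \<Gamma>) (H_half \<Gamma>) (H_half_norm \<Gamma>) S' T'"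
    and \<phi>: "\<phi> \<in> H_half \<Gamma>" and \<phi>_odd: "\<And>x. x \<in> \<Gamma> \<Longrightarrow> \<phi> (R x) = - \<phi> x"
    and u: "u \<in> H_half \<Gamma>"
  shows "T \<phi> u = T' \<phi> u"
proof -
  define \<psi> where "\<psi> = T \<phi>"
  have \<psi>: "\<psi> \<in> H_mhalf \<Gamma>" unfolding \<psi>_def by (rule op_half_mhalf_D(1)[OF T \<phi>])
  note R\<psi> = dual_R_H_mhalf[OF \<psi>]
  have left_inv: "T (S f) v = f v" "T' (S' f) v = f v" if "f \<in> H_mhalf \<Gamma>" "v \<in> H_half \<Gamma>" for f v
  proof -
    have "(\<lambda>v. T (S f) v - f v) \<in> H_mhalf \<Gamma>" "(\<lambda>v. T' (S' f) v - f v) \<in> H_mhalf \<Gamma>"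
      using that(1) by (auto intro!: H_mhalf_closed op_half_mhalf_D(1)[OF T] op_half_mhalf_D(1)[OF T']
        op_mhalf_half_D(1)[OF S] op_mhalf_half_D(1)[OF S'])
    moreover have "H_mhalf_norm \<Gamma> (\<lambda>v. T (S f) v - f v) = 0" "H_mhalf_norm \<Gamma> (\<lambda>v. T' (S' f) v - f v) = 0"
      using inv inv' that(1) unfolding inverse_ops_def by blast+
    ultimately show "T (S f) v = f v" "T' (S' f) v = f v"
      using that(2) by (auto simp: H_mhalf_norm_eq_0_iff)
  qed
  have S\<psi>: "AE x in M. S \<psi> x = \<phi> x"
  proof -
    have "H_half_norm \<Gamma> (\<lambda>y. S \<psi> y - \<phi> y) = 0"
      using inv \<phi> unfolding inverse_ops_def \<psi>_def by blast
    then show ?thesis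
      using H_half_norm_eq_0_iff[OF H_half_diff[OF op_mhalf_half_D(1)[OF S \<psi>] \<phi>]] by simp
  qed
  have odd: "dual_R \<psi> v = - \<psi> v" if v: "v \<in> H_half \<Gamma>" for v
  proof -
    define \<rho> where "\<rho> = (\<lambda>v. \<psi> v + dual_R \<psi> v)"
    have \<rho>: "\<rho> \<in> H_mhalf \<Gamma>" unfolding \<rho>_def by (rule H_mhalf_closed(1)[OF \<psi> R\<psi>])
    have "AE x in M. S \<rho> x = S \<psi> x + S (dual_R \<psi>) x"
      unfolding \<rho>_def by (rule op_mhalf_half_D(2)[OF S \<psi> R\<psi>])
    moreover have "AE x in M. S (dual_R \<psi>) x = S \<psi> (R x)"
      by (rule op_dual_R_commute[OF S rep G \<psi>])
    ultimately have "AE x in M. S \<rho> x = 0"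
      using S\<psi> AE_comp_R[OF S\<psi>] AE_space
      by eventually_elim (simp add: \<phi>_odd)
    then have "T (S \<rho>) v = T (\<lambda>x. 0) v"
      by (intro op_half_mhalf_D(4)[OF T] op_mhalf_half_D(1)[OF S \<rho>] H_half_zero v)
    also have "\<dots> = 0" using op_half_mhalf_D(3)[OF T H_half_zero v, of 0] by simp
    finally show ?thesis
      using left_inv(1)[OF \<rho> v] by (simp add: \<rho>_def add_eq_0_iff)
  qed
  have "AE x in M. S' \<psi> x = S \<psi> x"
    by (rule op_eq_on_odd[OF S S' rep rep' c c_int \<psi> odd])
  then have "AE x in M. S' \<psi> x = \<phi> x" using S\<psi> by eventually_elim simp
  then have "T' (S' \<psi>) u = T' \<phi> u"
    by (intro op_half_mhalf_D(4)[OF T'] op_mhalf_half_D(1)[OF S' \<psi>] \<phi> u)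
  then show ?thesis using left_inv(2)[OF \<psi> u] by (simp add: \<psi>_def)
qed

end

section \<open>Green's function and resonators\<close>

lemma beta_minus: "beta k (- \<eta>) = beta k \<eta>" "\<eta> \<noteq> 0 \<Longrightarrow> beta (- k) \<eta> = beta k \<eta>"
  by (simp_all add: beta_def)

lemma R_refl_simps [simp]:
  "R_refl (R_refl x) = x" "snd (R_refl x) = snd x" "fst (R_refl x) = - fst x"
  "R_refl x - R_refl y = R_refl (x - y)"
  by (simp_all add: R_refl_def prod_eq_iff)

lemma green_mode_reflect: "green_mode L k \<eta> (- z, t) = green_mode L k (- \<eta>) (z, t)"
  by (simp add: green_mode_def beta_minus)

text \<open>Reflecting x in the lattice directions amounts to reindexing the dual lattice by \<eta>
  -> -\<eta>, and \<open>infsum\<close> is invariant under bijections in every case. The sums agree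
  for each t, so their values off the plane and their limits on it agree.\<close>

lemma green_R_refl:
  fixes x :: "'n::finite point"
  shows "green L k (R_refl x) = green L k x"
proof -
  have bij: "bij_betw uminus (lattice a - {0}) (lattice a - {0 :: real ^ 'n})" for a :: real
  proof -
    have lat: "- \<eta> \<in> lattice a" if \<eta>: "\<eta> \<in> lattice a" for \<eta> :: "real ^ 'n"
    proof -
      obtain m :: "'n \<Rightarrow> int" where "\<eta> = (\<chi> i. a * of_int (m i))"
        using \<eta> unfolding lattice_def by blast
      then show ?thesis
        unfolding lattice_def by (intro image_eqI[where x = "\<lambda>i. - m i"]) (auto simp: vec_eq_iff)
    qed
    show ?thesis
      by (rule bij_betw_byWitness[where f' = uminus]) (auto simp: lat)
  qed
  have "(\<Sum>\<^sub>\<infinity>\<eta>\<in>lattice (2 * pi / L) - {0}. green_mode L k \<eta> (- fst x, t))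
    = (\<Sum>\<^sub>\<infinity>\<eta>\<in>lattice (2 * pi / L) - {0}. green_mode L k \<eta> (fst x, t))" for t
    unfolding green_mode_reflect
    by (rule infsum_reindex_bij_betw[OF bij, where f = "\<lambda>\<eta>. green_mode L k \<eta> (fst x, t)"])
  moreover have "green_mode L k 0 (R_refl x) = green_mode L k 0 x"
    by (simp add: green_mode_def)
  ultimately show ?thesis by (simp add: green_def)
qed

lemma green_uminus:
  "green L (- k) x = green L k x + (green_mode L (- k) 0 x - green_mode L k 0 x)"
proof -
  have "(\<Sum>\<^sub>\<infinity>\<eta>\<in>lattice (2 * pi / L) - {0}. green_mode L (- k) \<eta> (fst x, t))
    = (\<Sum>\<^sub>\<infinity>\<eta>\<in>lattice (2 * pi / L) - {0}. green_mode L k \<eta> (fst x, t))" for t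
    by (rule infsum_cong) (simp add: green_mode_def beta_minus)
  then show ?thesis by (simp add: green_def)
qed

lemma green_mode_0_eq:
  fixes x y :: "'n::finite point"
  shows "snd x = snd y \<Longrightarrow> green_mode L k 0 x = green_mode L k 0 y"
  by (simp add: green_mode_def)

lemma continuous_on_green_mode_0: "continuous_on A (\<lambda>y. green_mode L k 0 (x - y))"
  unfolding green_mode_def divide_inverse by (intro continuous_intros)

section \<open>Boundary indicators and the first-order coefficient\<close>

context finite_surface begin

text \<open>K lies at a positive distance \<delta> from the rest of the surface, and only pairs on
  different sides contribute to the seminorm, so its integrand is at most \<delta>^(-d) on a finite
  measure space.\<close>

lemma indicator_H_half:
  assumes K: "compact K" "closed (\<Gamma> - K)"
  shows "(indicator K :: 'a \<Rightarrow> complex) \<in> H_half \<Gamma>"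
proof -
  have "K \<in> sets borel" using K(1) by (simp add: borel_compact)
  then have "(indicator K :: 'a \<Rightarrow> complex) \<in> borel_measurable borel" by simp
  from measurable_compose[OF measurable_ident_surface this]
  have meas: "(indicator K :: 'a \<Rightarrow> complex) \<in> borel_measurable M" by simp
  obtain \<delta> where \<delta>: "\<delta> > 0" "\<And>x y. x \<in> K \<Longrightarrow> y \<in> \<Gamma> - K \<Longrightarrow> \<delta> \<le> dist x y"
    using separate_compact_closed[OF K] by auto
  have sq: "(cmod (indicator K x - indicator K y))\<^sup>2 / dist x y ^ DIM('a) \<le> 1 / \<delta> ^ DIM('a)"
    if "x \<in> \<Gamma>" "y \<in> \<Gamma>" for x y
  proof (cases "x \<in> K \<longleftrightarrow> y \<in> K")
    case False
    then have "\<delta> \<le> dist x y" using \<delta>(2)[of x y] \<delta>(2)[of y x] that by (auto simp: dist_commute)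
    then have "\<delta> ^ DIM('a) \<le> dist x y ^ DIM('a)" using \<delta>(1) by (intro power_mono) auto
    then show ?thesis using False \<delta>(1) by (auto simp: indicator_def intro!: divide_left_mono mult_pos_pos zero_less_power)
  qed (use \<delta>(1) in \<open>auto simp: indicator_def\<close>)
  have "(\<integral>\<^sup>+x. ennreal ((cmod (indicator K x))\<^sup>2) \<partial>M) \<le> (\<integral>\<^sup>+x. 1 \<partial>M)"
    by (intro nn_integral_mono) (auto simp: indicator_def)
  also have "\<dots> < \<infinity>" by (simp add: emeasure_eq_measure)
  finally have 1: "(\<integral>\<^sup>+x. ennreal ((cmod (indicator K x))\<^sup>2) \<partial>M) < \<infinity>" .
  have "(\<integral>\<^sup>+x. \<integral>\<^sup>+y. ennreal ((cmod (indicator K x - indicator K y))\<^sup>2 / dist x y ^ DIM('a)) \<partial>M \<partial>M)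
    \<le> (\<integral>\<^sup>+x. \<integral>\<^sup>+y. ennreal (1 / \<delta> ^ DIM('a)) \<partial>M \<partial>M)"
    using sq by (intro nn_integral_mono ennreal_leI) auto
  also have "\<dots> < \<infinity>"
    by (simp add: emeasure_eq_measure ennreal_mult_less_top)
  finally show ?thesis using meas 1 by (simp add: H_half_def H_half_sq_def)
qed

lemma H_half_sum:
  "(\<And>j. j \<in> A \<Longrightarrow> f j \<in> H_half \<Gamma>) \<Longrightarrow> (\<lambda>x. \<Sum>j\<in>A. q j * f j x) \<in> H_half \<Gamma>"
  by (induction A rule: infinite_finite_induct) (auto intro!: H_half_zero H_half_add H_half_cmult)

lemma op_half_mhalf_sum:
  assumes T: "op_half_mhalf T" and u: "u \<in> H_half \<Gamma>" and f: "\<And>j. j \<in> A \<Longrightarrow> f j \<in> H_half \<Gamma>"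
    and "finite A"
  shows "T (\<lambda>x. \<Sum>j\<in>A. q j * f j x) u = (\<Sum>j\<in>A. q j * T (f j) u)"
  using \<open>finite A\<close> f
proof (induction A rule: finite_induct)
  case empty
  then show ?case using op_half_mhalf_D(3)[OF T H_half_zero u, of 0] by simp
next
  case (insert j A)
  then show ?case
    using op_half_mhalf_D(2)[OF T H_half_cmult[of "f j" "q j"] H_half_sum[of A f q] u]
      op_half_mhalf_D(3)[OF T _ u, of "f j" "q j"] by simp
qed

text \<open>Subtracting the expansions at t and -t cancels the common values and S0, leaving 2 t S1
  of order t^2. Hence the modulus z of S1 at \<phi> and u satisfies z \<le> C t for all small t >
  0.\<close>

lemma inverse_expansion_first_order_eq_0:
  fixes T :: "complex \<Rightarrow> ('a \<Rightarrow> complex) \<Rightarrow> ('a \<Rightarrow> complex) \<Rightarrow> complex"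
  assumes ops: "op_half_mhalf S0" "op_half_mhalf S1"
    and d: "d > 0"
    and T: "\<And>\<omega>. \<omega> \<noteq> 0 \<Longrightarrow> cmod \<omega> < d \<Longrightarrow> op_half_mhalf (T \<omega>)"
    and expand: "\<And>\<omega>. \<omega> \<noteq> 0 \<Longrightarrow> cmod \<omega> < d \<Longrightarrow>
      H_mhalf_norm \<Gamma> (\<lambda>v. T \<omega> \<phi> v - (S0 \<phi> v + \<omega> * S1 \<phi> v)) \<le> K * (cmod \<omega>)\<^sup>2 * H_half_norm \<Gamma> \<phi>"
    and even: "\<And>\<omega>. \<omega> \<noteq> 0 \<Longrightarrow> cmod \<omega> < d \<Longrightarrow> T (- \<omega>) \<phi> u = T \<omega> \<phi> u"
    and \<phi>: "\<phi> \<in> H_half \<Gamma>" and u: "u \<in> H_half \<Gamma>"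
  shows "S1 \<phi> u = 0"
proof (rule ccontr)
  define C where "C = K * H_half_norm \<Gamma> \<phi> * H_half_norm \<Gamma> u"
  have remainder: "cmod (T \<omega> \<phi> u - (S0 \<phi> u + \<omega> * S1 \<phi> u)) \<le> C * (cmod \<omega>)\<^sup>2"
    if "\<omega> \<noteq> 0" "cmod \<omega> < d" for \<omega>
  proof -
    have "(\<lambda>v. T \<omega> \<phi> v - (S0 \<phi> v + \<omega> * S1 \<phi> v)) \<in> H_mhalf \<Gamma>"
      using op_half_mhalf_D(1)[OF T[OF that] \<phi>] op_half_mhalf_D(1)[OF ops(1) \<phi>]
        op_half_mhalf_D(1)[OF ops(2) \<phi>] by (intro H_mhalf_closed)
    from H_mhalf_norm_bound[OF this u] mult_right_mono[OF expand[OF that] H_half_norm_nonneg[of u]]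
    show ?thesis by (simp add: C_def mult_ac)
  qed
  assume "S1 \<phi> u \<noteq> 0"
  define z where "z = cmod (S1 \<phi> u)"
  have z: "z > 0" using \<open>S1 \<phi> u \<noteq> 0\<close> by (simp add: z_def)
  have bound: "z \<le> C * t" if t: "0 < t" "t < d" for t
  proof -
    let ?w = "complex_of_real t"
    have rem: "cmod (T ?w \<phi> u - (S0 \<phi> u + ?w * S1 \<phi> u)) \<le> C * t\<^sup>2"
      "cmod (T ?w \<phi> u - (S0 \<phi> u - ?w * S1 \<phi> u)) \<le> C * t\<^sup>2"
      using remainder[of ?w] remainder[of "- ?w"] even[of ?w] t by simp_all
    have "cmod ((T ?w \<phi> u - (S0 \<phi> u - ?w * S1 \<phi> u)) - (T ?w \<phi> u - (S0 \<phi> u + ?w * S1 \<phi> u)))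
      \<le> C * t\<^sup>2 + C * t\<^sup>2"
      by (rule order.trans[OF norm_triangle_ineq4 add_mono[OF rem(2,1)]])
    also have "(T ?w \<phi> u - (S0 \<phi> u - ?w * S1 \<phi> u)) - (T ?w \<phi> u - (S0 \<phi> u + ?w * S1 \<phi> u)) = 2 * ?w * S1 \<phi> u"
      by (simp add: algebra_simps)
    finally have "t * z \<le> t * (C * t)"
      using t by (simp add: norm_mult z_def power2_eq_square mult_ac)
    then show ?thesis using t by simp
  qed
  \<comment> \<open>Positivity of C follows from the bound itself; then t \<le> z / (2 C)
    contradicts z \<le> C t.\<close>
  have "0 < C * (d / 2)" using bound[of "d / 2"] z d by linarith
  then have "C > 0" using d by (simp add: zero_less_mult_iff)
  define t where "t = min (d / 2) (z / (2 * C))"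
  have "z \<le> C * t" using bound[of t] z d \<open>C > 0\<close> by (simp add: t_def)
  also have "\<dots> \<le> C * (z / (2 * C))" using \<open>C > 0\<close> by (intro mult_left_mono) (auto simp: t_def)
  finally show False using z \<open>C > 0\<close> by simp
qed

end

section \<open>Resonators under the reflection\<close>

lemma linear_R_refl: "linear R_refl"
  by (rule linearI) (simp_all add: R_refl_def prod_eq_iff)

lemma dist_R_refl: "dist (R_refl x) (R_refl y) = dist x y"
  by (simp add: R_refl_def dist_prod_def dist_minus)

lemma inj_R_refl: "inj R_refl"
  by (metis R_refl_simps(1) injI)

lemma mem_R_refl_image_iff: "x \<in> R_refl ` A \<longleftrightarrow> R_refl x \<in> A"
  using image_eqI[of x R_refl "R_refl x" A] by (auto elim!: imageE simp del: split_paired_All)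

lemma frontier_R_refl_image: "frontier (R_refl ` A) = R_refl ` frontier A"
  by (simp add: frontier_def image_set_diff[OF inj_R_refl] interior_injective_linear_image[OF linear_R_refl inj_R_refl]
    closure_injective_linear_image[OF linear_R_refl inj_R_refl])

lemma resonators_disjoint_closure:
  assumes "resonators L D" "i \<noteq> j"
  shows "closure (D i) \<inter> closure (D j) = {}"
proof -
  have "0 \<in> lattice L" unfolding lattice_def by (intro image_eqI[where x = "\<lambda>_. 0"]) (auto simp: vec_eq_iff)
  then have "(\<lambda>x. x + (0, 0)) ` closure (D i) \<inter> (\<lambda>x. x + (0, 0)) ` closure (D j) = {}"
    using assms unfolding resonators_def by blast
  then show ?thesis by (simp flip: zero_prod_def)
qed

lemma resonators_disjoint:
  assumes "resonators L D" "i \<noteq> j"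
  shows "D i \<inter> D j = {}"
  using resonators_disjoint_closure[OF assms] closure_subset by blast

text \<open>Finiteness of the family lets closure commute with the union, and disjoint closures keep
  a frontier point of one resonator out of all the others.\<close>

lemma frontier_Union_resonators:
  fixes D :: "'m::finite \<Rightarrow> 'n::finite point set"
  assumes D: "resonators L D"
  shows "frontier (\<Union>i. D i) = (\<Union>i. frontier (D i))"
proof -
  have op: "open (D i)" for i using D by (simp add: resonators_def)
  have "closure (\<Union>i. D i) = (\<Union>i. closure (D i))"
  proof (rule antisym)
    show "closure (\<Union>i. D i) \<subseteq> (\<Union>i. closure (D i))"
      using closure_subset by (intro closure_minimal closed_UN) auto
    show "(\<Union>i. closure (D i)) \<subseteq> closure (\<Union>i. D i)"
      by (intro UN_least closure_mono) auto
  qed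
  moreover have "interior (\<Union>i. D i) = (\<Union>i. D i)" by (intro interior_open open_UN) (use op in auto)
  moreover have "(\<Union>i. closure (D i)) - (\<Union>i. D i) = (\<Union>i. closure (D i) - D i)"
  proof (intro equalityI subsetI)
    fix x assume "x \<in> (\<Union>i. closure (D i) - D i)"
    then obtain i where i: "x \<in> closure (D i)" "x \<notin> D i" by blast
    have "x \<notin> D j" for j
      using i resonators_disjoint_closure[OF D, of i j] closure_subset[of "D j"] by (cases "j = i") auto
    with i show "x \<in> (\<Union>i. closure (D i)) - (\<Union>i. D i)" by blast
  qed blast
  ultimately show ?thesis by (simp add: frontier_def interior_open op)
qed

lemma frontier_resonators_disjoint:
  assumes "resonators L D" "i \<noteq> j"
  shows "frontier (D i) \<inter> frontier (D j) = {}"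
  using resonators_disjoint_closure[OF assms] by (auto simp: frontier_def)

text \<open>The resonators and their reflections are two decompositions of the same set into
  disjoint nonempty connected open sets, and such a decomposition is unique. Disjointness and
  nonemptiness also make j unique, as the \<open>THE\<close> in \<open>refl_perm\<close>
  requires.\<close>

lemma R_refl_resonator:
  fixes D :: "'m::finite \<Rightarrow> 'n::finite point set"
  assumes D: "resonators L D" and sym: "R_refl ` (\<Union>i. D i) = (\<Union>i. D i)"
  shows "R_refl ` D i = D (refl_perm D i)"
proof -
  have D_i: "open (D i) \<and> connected (D i) \<and> D i \<noteq> {}" for i
    using D by (simp add: resonators_def)
  have disjnt_range: "pairwise disjnt (range f)" if "\<And>i j. i \<noteq> j \<Longrightarrow> f i \<inter> f j = {}"
    for f :: "'m \<Rightarrow> 'n point set"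
    unfolding pairwise_def disjnt_def using that by (metis rangeE)
  have "range (\<lambda>i. R_refl ` D i) = range D"
  proof (rule connected_disjoint_Union_open_unique)
    show "pairwise disjnt (range D)"
      by (rule disjnt_range) (rule resonators_disjoint[OF D])
    have "R_refl ` D i \<inter> R_refl ` D j = {}" if "i \<noteq> j" for i j
      using resonators_disjoint[OF D that] inj_R_refl by (metis image_Int image_empty)
    then show "pairwise disjnt (range (\<lambda>i. R_refl ` D i))"
      by (rule disjnt_range)
    show "\<Union>(range (\<lambda>i. R_refl ` D i)) = \<Union>(range D)"
      using sym by (simp add: image_UN)
    show "open S \<and> connected S \<and> S \<noteq> {}" if "S \<in> range D" for S
      using that D_i by blast
    show "open S \<and> connected S \<and> S \<noteq> {}" if "S \<in> range (\<lambda>i. R_refl ` D i)" for S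
    proof -
      obtain i where S: "S = R_refl ` D i" using \<open>S \<in> _\<close> by blast
      have "open S"
        unfolding S using D_i[of i] linear_injective_imp_surjective[OF linear_R_refl inj_R_refl]
        by (intro open_surjective_linear_image linear_R_refl) simp_all
      moreover have "connected S"
        unfolding S using D_i[of i] by (intro connected_linear_image linear_R_refl) auto
      ultimately show ?thesis using D_i[of i] by (simp add: S)
    qed
  qed
  then obtain j where j: "R_refl ` D i = D j" by blast
  have "k = j" if "R_refl ` D i = D k" for k
    using that j resonators_disjoint[OF D, of j k] D_i[of j] by auto
  then have "refl_perm D i = j" unfolding refl_perm_def using j by (intro the_equality)
  then show ?thesis using j by simp
qed

lemma refl_perm_refl_perm:
  fixes D :: "'m::finite \<Rightarrow> 'n::finite point set"
  assumes D: "resonators L D" and sym: "R_refl ` (\<Union>i. D i) = (\<Union>i. D i)"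
  shows "refl_perm D (refl_perm D i) = i"
proof (rule ccontr)
  assume ne: "refl_perm D (refl_perm D i) \<noteq> i"
  have "D (refl_perm D (refl_perm D i)) = R_refl ` R_refl ` D i"
    by (simp add: R_refl_resonator[OF D sym])
  also have "\<dots> = D i" by (simp add: image_image)
  finally show False
    using resonators_disjoint[OF D ne] D by (auto simp: resonators_def)
qed

lemma symmetric_surface_resonators:
  fixes D :: "'m::finite \<Rightarrow> 'n::finite point set"
  assumes D: "resonators L D" and sym: "R_refl ` (\<Union>i. D i) = (\<Union>i. D i)"
  shows "symmetric_surface (frontier (\<Union>i. D i)) R_refl"
proof
  let ?\<Gamma> = "frontier (\<Union>i. D i)"
  show borel: "?\<Gamma> \<in> sets borel" by (rule borel_closed) simp
  have "emeasure (hausdorff_measure CARD('n)) ?\<Gamma>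
    \<le> (\<Sum>i\<in>UNIV. emeasure (hausdorff_measure CARD('n)) (frontier (D i)))"
    unfolding frontier_Union_resonators[OF D]
    by (rule emeasure_subadditive_finite) (auto intro: borel_closed)
  also have "\<dots> < \<infinity>"
    using D emeasure_frontier_C2_finite[of "D _"] by (simp add: resonators_def)
  finally show "emeasure (surface_measure ?\<Gamma>) ?\<Gamma> < \<infinity>"
    by (simp add: emeasure_surface_measure_space[OF borel])
  show "R_refl ` ?\<Gamma> = ?\<Gamma>" by (simp add: sym flip: frontier_R_refl_image)
qed (simp_all add: dist_R_refl)

theorem lemma4p1:
  fixes L c :: real
    and D :: "'m::finite \<Rightarrow> 'n::finite point set"
    and S0 S1 :: "'n wave \<Rightarrow> 'n dual_wave"
    and q :: "complex ^ 'm"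
  assumes "DIM('n point) \<in> {2, 3}"
    and "L > 0" and "c > 0"
    and "resonators L D"
    and "inverse_expansion L c (frontier (\<Union>i. D i)) S0 S1"
    and "R_refl ` (\<Union>i. D i) = (\<Union>i. D i)"
    and "Pi_matrix D *v q = - q"
  shows "C1_matrix D S1 *v q = 0"
proof -
  note D = \<open>resonators L D\<close> and sym = \<open>R_refl ` (\<Union>i. D i) = (\<Union>i. D i)\<close>
  define \<Gamma> where "\<Gamma> = frontier (\<Union>i. D i)"
  interpret symmetric_surface \<Gamma> R_refl
    unfolding \<Gamma>_def by (rule symmetric_surface_resonators[OF D sym])
  let ?\<pi> = "refl_perm D"
  define ind :: "'m \<Rightarrow> 'n wave" where "ind j = indicator (frontier (D j))" for j
  define \<phi> where "\<phi> x = (\<Sum>j\<in>UNIV. q $ j * ind j x)" for x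
  have compact_frontier: "compact (frontier (D j))" for j
    using D by (intro compact_frontier_bounded) (simp add: resonators_def)
  have \<Gamma>: "\<Gamma> = (\<Union>j. frontier (D j))" unfolding \<Gamma>_def by (rule frontier_Union_resonators[OF D])
  have ind: "ind j \<in> H_half \<Gamma>" for j
  proof -
    have "\<Gamma> - frontier (D j) = (\<Union>i\<in>-{j}. frontier (D i))"
      using frontier_resonators_disjoint[OF D, of _ j] unfolding \<Gamma> by blast
    moreover have "closed \<dots>" by (intro closed_UN) auto
    ultimately show ?thesis unfolding ind_def by (intro indicator_H_half compact_frontier) simp
  qed
  have \<phi>: "\<phi> \<in> H_half \<Gamma>" unfolding \<phi>_def by (rule H_half_sum) (rule ind)
  have \<pi>: "?\<pi> (?\<pi> i) = i" for i by (rule refl_perm_refl_perm[OF D sym])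
  have q: "q $ ?\<pi> i = - q $ i" for i
  proof -
    have "(Pi_matrix D *v q) $ i = q $ ?\<pi> i"
      \<comment> \<open>Row i of the permutation matrix picks out the entry of q at the reflected
        index, so the eigenvector equation is antisymmetry of q.\<close>
      by (simp add: matrix_vector_mult_def Pi_matrix_def if_distrib if_distribR cong: if_cong)
    then show ?thesis using \<open>Pi_matrix D *v q = - q\<close> by simp
  qed
  have \<phi>_odd: "\<phi> (R_refl x) = - \<phi> x" for x
  proof -
    have "ind j (R_refl x) = ind (?\<pi> j) x" for j
    proof -
      have "frontier (D (?\<pi> j)) = R_refl ` frontier (D j)"
        by (simp flip: frontier_R_refl_image R_refl_resonator[OF D sym])
      moreover have "x \<in> R_refl ` frontier (D j) \<longleftrightarrow> R_refl x \<in> frontier (D j)"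
        by (rule mem_R_refl_image_iff)
      ultimately show ?thesis by (simp add: ind_def indicator_def)
    qed
    then have "\<phi> (R_refl x) = (\<Sum>j\<in>UNIV. q $ j * ind (?\<pi> j) x)" by (simp add: \<phi>_def)
    \<comment> \<open>Reindexing by the involution moves the permutation from the indicators to the
      coefficients, where antisymmetry of q applies.\<close>
    also have "\<dots> = (\<Sum>j\<in>UNIV. q $ ?\<pi> j * ind j x)"
      by (rule sum.reindex_bij_witness[of _ ?\<pi> ?\<pi>]) (simp_all add: \<pi>)
    finally show ?thesis by (simp add: q \<phi>_def sum_negf)
  qed
  have ops: "op_half_mhalf S0" "op_half_mhalf S1"
    using assms(5) unfolding inverse_expansion_def \<Gamma>_def by auto
  define good where "good K \<omega> S T \<longleftrightarrow> single_layer L \<Gamma> (\<omega> / of_real c) S \<and> op_half_mhalf T \<and>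
      inverse_ops (H_mhalf \<Gamma>) (H_mhalf_norm \<Gamma>) (H_half \<Gamma>) (H_half_norm \<Gamma>) S T \<and>
      (\<forall>\<phi>\<in>H_half \<Gamma>. H_mhalf_norm \<Gamma> (\<lambda>v. T \<phi> v - (S0 \<phi> v + \<omega> * S1 \<phi> v))
           \<le> K * (cmod \<omega>)\<^sup>2 * H_half_norm \<Gamma> \<phi>)" for K \<omega> S T
  obtain K where "\<forall>\<^sub>F \<omega> in at 0. \<exists>S T. good K \<omega> S T"
    using assms(5) unfolding inverse_expansion_def \<Gamma>_def[symmetric] good_def by blast
  then obtain d where d: "d > 0" "\<And>\<omega>. \<omega> \<noteq> 0 \<Longrightarrow> cmod \<omega> < d \<Longrightarrow> \<exists>S T. good K \<omega> S T"
    unfolding eventually_at by auto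
  \<comment> \<open>The punctured disc is invariant under negation, so operators are available at
    both \<omega> and -\<omega>; the choices at the two points are unrelated.\<close>
  then obtain S T where ST: "\<And>\<omega>. \<omega> \<noteq> 0 \<Longrightarrow> cmod \<omega> < d \<Longrightarrow> good K \<omega> (S \<omega>) (T \<omega>)"
    by metis
  have S1_zero: "S1 \<phi> u = 0" if u: "u \<in> H_half \<Gamma>" for u
  proof (rule inverse_expansion_first_order_eq_0[where T = T, OF ops d(1) _ _ _ \<phi> u])
    fix \<omega> :: complex assume \<omega>: "\<omega> \<noteq> 0" "cmod \<omega> < d"
    have g: "good K \<omega> (S \<omega>) (T \<omega>)" "good K (- \<omega>) (S (- \<omega>)) (T (- \<omega>))"
      using ST[of \<omega>] ST[of "- \<omega>"] \<omega> by auto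
    show "op_half_mhalf (T \<omega>)" using g(1) unfolding good_def by blast
    show "H_mhalf_norm \<Gamma> (\<lambda>v. T \<omega> \<phi> v - (S0 \<phi> v + \<omega> * S1 \<phi> v)) \<le> K * (cmod \<omega>)\<^sup>2 * H_half_norm \<Gamma> \<phi>"
      using g(1) \<phi> unfolding good_def by blast
    define k where "k = \<omega> / complex_of_real c"
    define e where "e x y = green_mode L (- k) 0 (x - y) - green_mode L k 0 (x - y)" for x y :: "'n point"
    have layer: "single_layer L \<Gamma> k (S \<omega>)" "single_layer L \<Gamma> (- k) (S (- \<omega>))"
      using g unfolding good_def k_def by auto
    have "T \<omega> \<phi> u = T (- \<omega>) \<phi> u"
    proof (rule inverse_eq_on_odd[where S = "S \<omega>" and S' = "S (- \<omega>)" and G = "\<lambda>x y. green L k (x - y)" and c = e,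
          OF _ _ _ _ _ _ _ _ _ _ _ \<phi> \<phi>_odd u])
      show "op_mhalf_half (S \<omega>)" "op_mhalf_half (S (- \<omega>))"
        using layer unfolding single_layer_def by auto
      show "AE x in M. S \<omega> (of_density \<Gamma> g) x = (LINT y|M. green L k (x - y) * g y)"
        if "g \<in> L2_space \<Gamma>" for g
        using layer(1) that unfolding single_layer_def by blast
      show "AE x in M. S (- \<omega>) (of_density \<Gamma> g) x = (LINT y|M. (green L k (x - y) + e x y) * g y)"
        if "g \<in> L2_space \<Gamma>" for g
        using layer(2) that unfolding single_layer_def e_def green_uminus[symmetric] by blast
      show "green L k (R_refl x - R_refl y) = green L k (x - y)" for x y
        by (simp add: green_R_refl)
      show "e x (R_refl y) = e x y" for x y
        unfolding e_def by (intro arg_cong2[of _ _ _ _ "(-)"] green_mode_0_eq) simp_all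
      show "integrable M (\<lambda>y. e x y * g y)" if "g \<in> L2_space \<Gamma>" for x g
      proof -
        \<comment> \<open>The jump e between the two kernels is a difference of zero modes, which
          are continuous even across the plane where the last coordinate vanishes. It is therefore
          bounded on the compact surface, and its product with g is integrable.\<close>
        have cont: "continuous_on UNIV (e x)"
          unfolding e_def[abs_def] by (intro continuous_on_diff continuous_on_green_mode_0)
        have "compact \<Gamma>" unfolding \<Gamma> by (intro compact_UN compact_frontier) simp
        then have "bounded (e x ` \<Gamma>)"
          using cont by (intro compact_imp_bounded compact_continuous_image continuous_on_subset[OF cont]) auto
        then obtain B where B: "\<And>y. y \<in> \<Gamma> \<Longrightarrow> cmod (e x y) \<le> B" by (auto simp: bounded_iff)
        have [measurable]: "e x \<in> borel_measurable M"
          by (rule measurable_compose[OF measurable_ident_surface borel_measurable_continuous_onI[OF cont]])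
        note [measurable] = L2_measurable[OF that]
        show ?thesis
        proof (rule Bochner_Integration.integrable_bound)
          show "integrable M (\<lambda>y. of_real B * g y)" using L2_integrable[OF that] by simp
          show "AE y in M. norm (e x y * g y) \<le> norm (of_real B * g y)"
            by (rule AE_I2) (use B in \<open>auto simp: norm_mult intro!: mult_right_mono order.trans[OF _ abs_ge_self]\<close>)
        qed measurable
      qed
      show "op_half_mhalf (T \<omega>)" "op_half_mhalf (T (- \<omega>))"
        "inverse_ops (H_mhalf \<Gamma>) (H_mhalf_norm \<Gamma>) (H_half \<Gamma>) (H_half_norm \<Gamma>) (S \<omega>) (T \<omega>)"
        "inverse_ops (H_mhalf \<Gamma>) (H_mhalf_norm \<Gamma>) (H_half \<Gamma>) (H_half_norm \<Gamma>) (S (- \<omega>)) (T (- \<omega>))"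
        using g unfolding good_def by auto
    qed
    then show "T (- \<omega>) \<phi> u = T \<omega> \<phi> u" ..
  qed
  have "(C1_matrix D S1 *v q) $ i = 0" for i
  proof -
    \<comment> \<open>Pairing with 1 over the i-th boundary is evaluation at its indicator, itself a
      test function in \<open>H_half\<close>. By linearity the matrix product becomes S1 \<phi> at
      that indicator.\<close>
    have "(C1_matrix D S1 *v q) $ i = - (\<Sum>j\<in>UNIV. q $ j * S1 (ind j) (ind i))"
      by (simp add: matrix_vector_mult_def C1_matrix_def pairing_on_def ind_def sum_negf mult.commute)
    also have "(\<Sum>j\<in>UNIV. q $ j * S1 (ind j) (ind i)) = S1 \<phi> (ind i)"
      unfolding \<phi>_def[abs_def] by (rule op_half_mhalf_sum[OF ops(2) ind ind, symmetric]) simp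
    finally show ?thesis by (simp add: S1_zero[OF ind])
  qed
  then show ?thesis by (simp add: vec_eq_iff)
qed

end
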